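(* Let $A\in\mathbb{R}^{m\times n}$ ($m\ge n$) have simple singular values $\sigma_1>\cdots>\sigma_n>0$, $b\in\mathbb{R}^m$, and assume that the discrete Picard condition with parameter $\beta>0$ is satisfied (in the sense of the context). Let $\gamma_k=\|A-P_{k+1}B_kQ_k^T\|$, where $P_{k+1},B_k,Q_k$ are generated by $k$-step Lanczos bidiagonalization, and let $\eta_k$ be as defined in the context. Call $P_{k+1}B_kQ_k^T$ a near best rank $k$ approximation to $A$ if $\sigma_{k+1}\le\gamma_k<\sigma_k$ and $\gamma_k-\sigma_{k+1}<\sigma_k-\gamma_k$, i.e. $\gamma_k<\frac{\sigma_k+\sigma_{k+1}}{2}$. Then $P_{k+1}B_kQ_k^T$ is a near best rank $k$ approximation to $A$ for $k=1,2,\dots,k_0$ if, for these $k$, $$\sqrt{1+\eta_k^2}<\frac12\frac{\sigma_k}{\sigma_{k+1}}+\frac12.$$ For the severely ill-posed problems with $\sigma_k=\zeta\rho^{-k}$ ($\zeta>0$, $\rho>1$), $P_{k+1}B_kQ_k^T$ is a near best rank $k$ approximation to $A$ for $k=1,2,\dots,k_0$ if $\rho>2$; for the moderately or mildly ill-posed problems with $\sigma_k=\zeta k^{-\alpha}$ ($\zeta>0$, $\alpha>\frac12$), $P_{k+1}B_kQ_k^T$ is a near best rank $k$ approximation to $A$ for $k=1,2,\dots,k_0$ if $\alpha$ satisfies, for these $k$, $$2\sqrt{1+\eta_k^2}-1<\left(\frac{k_0+1}{k_0}\right)^{\alpha}.$$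
   Context: $\|\cdot\|$ is the 2-norm. The SVD of $A$ is $A=U\begin{pmatrix}\Sigma\\ \mathbf{0}\end{pmatrix}V^T$ with $U=(u_1,\dots,u_m)$, $V=(v_1,\dots,v_n)$ orthogonal, $\Sigma=\mathrm{diag}(\sigma_1,\dots,\sigma_n)$; $\Sigma_k=\mathrm{diag}(\sigma_1,\dots,\sigma_k)$. Lanczos bidiagonalization: $p_1=b/\|b\|$, $\beta_1q_0=0$; for $j=1,\dots,k$: $r=A^Tp_j-\beta_jq_{j-1}$, $\alpha_j=\|r\|$, $q_j=r/\alpha_j$, $z=Aq_j-\alpha_jp_j$, $\beta_{j+1}=\|z\|$, $p_{j+1}=z/\beta_{j+1}$. $P_{k+1}=(p_1,\dots,p_{k+1})$, $Q_k=(q_1,\dots,q_k)$ have orthonormal columns, and $B_k=P_{k+1}^TAQ_k\in\mathbb{R}^{(k+1)\times k}$ is lower bidiagonal with diagonal $\alpha_1,\dots,\alpha_k$ and subdiagonal $\beta_2,\dots,\beta_{k+1}$; $AQ_k=P_{k+1}B_k$. Definition of $\Delta_k\in\mathbb{R}^{(n-k)\times k}$ (all $u_i^Tb\ne0$): let $D=\mathrm{diag}(\sigma_iu_i^Tb)\in\mathbb{R}^{n\times n}$ and let $T_k\in\mathbb{R}^{n\times k}$ have $i$-th row $(1,\sigma_i^2,\dots,\sigma_i^{2k-2})$. Partition $D=\mathrm{diag}(D_1,D_2)$ with $D_1\in\mathbb{R}^{k\times k}$ and $T_k=\begin{pmatrix}T_{k1}\\ T_{k2}\end{pmatrix}$ with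 $T_{k1}\in\mathbb{R}^{k\times k}$ (nonsingular). Then $\Delta_k=D_2T_{k2}T_{k1}^{-1}D_1^{-1}$. Definition of $\eta_k\ge0$: $\eta_k^2\sigma_{k+1}^2=\|\Sigma_k(I+\Delta_k^T\Delta_k)^{-1}\Delta_k^T\Delta_k\|^2+\|\Sigma_k(I+\Delta_k^T\Delta_k)^{-1}\Delta_k^T\|^2$. Discrete Picard condition and noise model: $b=\hat b+e$ with $|u_i^T\hat b|=\sigma_i^{1+\beta}$, $i=1,\dots,n$, $\beta>0$, and $e$ white noise of level $\eta>0$ (unrelated to $\eta_k$), i.e. $|u_i^Te|\approx\eta$. The transition index $k_0$ is the index at which $|u_{k_0}^T b|\approx|u_{k_0}^T\hat b|>|u_{k_0}^Te|\approx\eta$ and $|u_{k_0+1}^Tb|\approx|u_{k_0+1}^Te|\approx\eta$. These relations are used in the following exact idealized form: $|u_j^Tb|=\sigma_j^{1+\beta}$ for $j\le k_0$; $|u_j^Tb|=\eta$ for $k_0<j\le n$; $|u_{j+1}^Tb|\le|u_j^Tb|$ for $1\le j\le n-1$; and $|u_{k+1}^Tb|/|u_k^Tb|=(\sigma_{k+1}/\sigma_k)^{1+\beta}$ for $k\le k_0$, $|u_{k+1}^Tb|/|u_k^Tb|=1$ for $k>k_0$. *)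

theory Defs
  imports Complex_Main "Jordan_Normal_Form.Gauss_Jordan_Elimination"
begin

text \<open>
  Singular values and the Lanczos quantities carry their customary indices starting at 1
  (\<open>\<sigma> 1\<close>, \<open>\<sigma> 2\<close>, ...), as functions on \<open>nat\<close>; matrix and vector entries are indexed from 0.
\<close>

definition norm2_vec :: "real vec \<Rightarrow> real" where
  "norm2_vec x = sqrt (x \<bullet> x)"

definition norm2_mat :: "real mat \<Rightarrow> real" where
  "norm2_mat M = Sup {norm2_vec (M *\<^sub>v x) | x. x \<in> carrier_vec (dim_col M) \<and> norm2_vec x \<le> 1}"

definition is_svd :: "nat \<Rightarrow> nat \<Rightarrow> real mat \<Rightarrow> real mat \<Rightarrow> (nat \<Rightarrow> real) \<Rightarrow> real mat \<Rightarrow> bool" where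
  "is_svd m n A U \<sigma> V \<longleftrightarrow>
     A \<in> carrier_mat m n \<and>
     U \<in> carrier_mat m m \<and> U\<^sup>T * U = 1\<^sub>m m \<and>
     V \<in> carrier_mat n n \<and> V\<^sup>T * V = 1\<^sub>m n \<and>
     A = U * (mat_diag n (\<lambda>i. \<sigma> (Suc i)) @\<^sub>r 0\<^sub>m (m - n) n) * V\<^sup>T"

text \<open>The coefficient \<open>u_i^T b\<close> for \<open>i \<ge> 1\<close>, where \<open>u_i\<close> is the \<open>i\<close>-th column of \<open>U\<close>.\<close>

definition ucoef :: "real mat \<Rightarrow> real vec \<Rightarrow> nat \<Rightarrow> real" where
  "ucoef U b i = col U (i - 1) \<bullet> b"

text \<open>
  The state after \<open>j\<close> steps is \<open>(\<alpha>_j, q_j, \<beta>_(j+1), p_(j+1))\<close>. The initial values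
  \<open>\<beta>_1 = 0\<close> and \<open>q_0 = 0\<close> realize the convention \<open>\<beta>_1 q_0 = 0\<close>; the initial \<open>\<alpha>\<close> is a dummy.
\<close>

primrec lanczos :: "real mat \<Rightarrow> real vec \<Rightarrow> nat \<Rightarrow> real \<times> real vec \<times> real \<times> real vec" where
  "lanczos A b 0 = (0, 0\<^sub>v (dim_col A), 0, (1 / norm2_vec b) \<cdot>\<^sub>v b)"
| "lanczos A b (Suc j) =
     (case lanczos A b j of (_, q, bet, p) \<Rightarrow>
        let r = A\<^sup>T *\<^sub>v p - bet \<cdot>\<^sub>v q;
            alp' = norm2_vec r;
            q' = (1 / alp') \<cdot>\<^sub>v r;
            z = A *\<^sub>v q' - alp' \<cdot>\<^sub>v p;
            bet' = norm2_vec z;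
            p' = (1 / bet') \<cdot>\<^sub>v z
        in (alp', q', bet', p'))"

definition lanczos_q :: "real mat \<Rightarrow> real vec \<Rightarrow> nat \<Rightarrow> real vec" where
  "lanczos_q A b j = fst (snd (lanczos A b j))"

definition lanczos_p :: "real mat \<Rightarrow> real vec \<Rightarrow> nat \<Rightarrow> real vec" where
  "lanczos_p A b j = snd (snd (snd (lanczos A b (j - 1))))"

text \<open>\<open>lanczos_Q A b k\<close> is \<open>Q_k\<close>, and \<open>lanczos_P A b (k + 1)\<close> is \<open>P_(k+1)\<close>.\<close>

definition lanczos_Q :: "real mat \<Rightarrow> real vec \<Rightarrow> nat \<Rightarrow> real mat" where
  "lanczos_Q A b k = mat_of_cols (dim_col A) (map (lanczos_q A b) [1..<Suc k])"

definition lanczos_P :: "real mat \<Rightarrow> real vec \<Rightarrow> nat \<Rightarrow> real mat" where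
  "lanczos_P A b k = mat_of_cols (dim_row A) (map (lanczos_p A b) [1..<Suc k])"

definition lanczos_B :: "real mat \<Rightarrow> real vec \<Rightarrow> nat \<Rightarrow> real mat" where
  "lanczos_B A b k = (lanczos_P A b (Suc k))\<^sup>T * A * lanczos_Q A b k"

definition lanczos_approx :: "real mat \<Rightarrow> real vec \<Rightarrow> nat \<Rightarrow> real mat" where
  "lanczos_approx A b k =
     lanczos_P A b (Suc k) * lanczos_B A b k * (lanczos_Q A b k)\<^sup>T"

definition gamma :: "real mat \<Rightarrow> real vec \<Rightarrow> nat \<Rightarrow> real" where
  "gamma A b k = norm2_mat (A - lanczos_approx A b k)"

definition near_best :: "real mat \<Rightarrow> real vec \<Rightarrow> (nat \<Rightarrow> real) \<Rightarrow> nat \<Rightarrow> bool" where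
  "near_best A b \<sigma> k \<longleftrightarrow>
     \<sigma> (Suc k) \<le> gamma A b k \<and> gamma A b k < \<sigma> k \<and>
     gamma A b k - \<sigma> (Suc k) < \<sigma> k - gamma A b k"

text \<open>
  \<open>mat_inverse\<close> returns an option; the matrices inverted below are nonsingular (a Vandermonde
  matrix with distinct positive nodes, a diagonal matrix with nonzero entries, and
  \<open>I + \<Delta>^T \<Delta>\<close>).
\<close>

definition minv :: "real mat \<Rightarrow> real mat" where
  "minv M = the (mat_inverse M)"

definition T_mat :: "nat \<Rightarrow> (nat \<Rightarrow> real) \<Rightarrow> nat \<Rightarrow> real mat" where
  "T_mat n \<sigma> k = mat n k (\<lambda>(i, j). \<sigma> (Suc i) ^ (2 * j))"

definition D_mat :: "nat \<Rightarrow> real mat \<Rightarrow> (nat \<Rightarrow> real) \<Rightarrow> real vec \<Rightarrow> real mat" where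
  "D_mat n U \<sigma> b = mat_diag n (\<lambda>i. \<sigma> (Suc i) * ucoef U b (Suc i))"

definition Delta :: "nat \<Rightarrow> real mat \<Rightarrow> (nat \<Rightarrow> real) \<Rightarrow> real vec \<Rightarrow> nat \<Rightarrow> real mat" where
  "Delta n U \<sigma> b k =
     (let T = T_mat n \<sigma> k;
          D = D_mat n U \<sigma> b;
          T1 = mat k k (\<lambda>(i, j). T $$ (i, j));
          T2 = mat (n - k) k (\<lambda>(i, j). T $$ (k + i, j));
          D1 = mat k k (\<lambda>(i, j). D $$ (i, j));
          D2 = mat (n - k) (n - k) (\<lambda>(i, j). D $$ (k + i, k + j))
      in D2 * T2 * minv T1 * minv D1)"

text \<open>
  The nonnegative solution of
  \<open>\<eta>_k^2 \<sigma>_(k+1)^2 = \<parallel>\<Sigma>_k (I + \<Delta>^T \<Delta>)^(-1) \<Delta>^T \<Delta>\<parallel>^2 + \<parallel>\<Sigma>_k (I + \<Delta>^T \<Delta>)^(-1) \<Delta>^T\<parallel>^2\<close>.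
\<close>

definition eta_rhs :: "nat \<Rightarrow> real mat \<Rightarrow> (nat \<Rightarrow> real) \<Rightarrow> real vec \<Rightarrow> nat \<Rightarrow> real" where
  "eta_rhs n U \<sigma> b k =
     (let \<Delta> = Delta n U \<sigma> b k;
          S = mat_diag k (\<lambda>i. \<sigma> (Suc i));
          W = minv (1\<^sub>m k + \<Delta>\<^sup>T * \<Delta>)
      in (norm2_mat (S * W * \<Delta>\<^sup>T * \<Delta>))\<^sup>2 + (norm2_mat (S * W * \<Delta>\<^sup>T))\<^sup>2)"

definition eta :: "nat \<Rightarrow> real mat \<Rightarrow> (nat \<Rightarrow> real) \<Rightarrow> real vec \<Rightarrow> nat \<Rightarrow> real" where
  "eta n U \<sigma> b k = sqrt (eta_rhs n U \<sigma> b k) / \<sigma> (Suc k)"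

lemma eta_rhs_nonneg: "0 \<le> eta_rhs n U \<sigma> b k"
  by (simp add: eta_rhs_def Let_def)

lemma eta_characterization:
  assumes "\<sigma> (Suc k) > 0"
  shows "h = eta n U \<sigma> b k \<longleftrightarrow> h \<ge> 0 \<and> h\<^sup>2 * (\<sigma> (Suc k))\<^sup>2 = eta_rhs n U \<sigma> b k"
proof -
  have "h \<ge> 0 \<and> h\<^sup>2 * (\<sigma> (Suc k))\<^sup>2 = eta_rhs n U \<sigma> b k \<Longrightarrow> h = eta n U \<sigma> b k"
    using assms by (metis eta_def less_irrefl nonzero_mult_div_cancel_right
        mult_nonneg_nonneg less_imp_le power_mult_distrib real_sqrt_abs abs_of_nonneg)
  moreover have "0 \<le> eta n U \<sigma> b k"
    using assms by (simp add: eta_def eta_rhs_nonneg)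
  moreover have "(eta n U \<sigma> b k)\<^sup>2 * (\<sigma> (Suc k))\<^sup>2 = eta_rhs n U \<sigma> b k"
    using assms by (simp add: eta_def eta_rhs_nonneg power_divide)
  ultimately show ?thesis by blast
qed

text \<open>
  Discrete Picard condition with parameter \<open>\<beta>\<close>, noise level \<open>\<epsilon>\<close> and transition index \<open>k0\<close>, with
  the approximate relations for \<open>b = bhat + e\<close> idealized to exact ones for \<open>b\<close>. The relation
  \<open>\<bar>u_i^T e\<bar> \<approx> \<epsilon>\<close> enters only through these: made exact for \<open>i \<le> k0\<close> it would contradict
  \<open>\<bar>u_i^T b\<bar> = \<bar>u_i^T bhat\<bar> > \<epsilon>\<close>.
\<close>

definition picard_model ::
  "nat \<Rightarrow> nat \<Rightarrow> real mat \<Rightarrow> (nat \<Rightarrow> real) \<Rightarrow> real vec \<Rightarrow> real vec \<Rightarrow> real vec \<Rightarrow> real \<Rightarrow> real \<Rightarrow> nat \<Rightarrow> bool" where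
  "picard_model m n U \<sigma> b bhat e \<beta> \<epsilon> k0 \<longleftrightarrow>
     bhat \<in> carrier_vec m \<and> e \<in> carrier_vec m \<and> b = bhat + e \<and>
     \<beta> > 0 \<and> \<epsilon> > 0 \<and> 1 \<le> k0 \<and> k0 < n \<and>
     (\<forall>i\<in>{1..n}. \<bar>ucoef U bhat i\<bar> = \<sigma> i powr (1 + \<beta>)) \<and>
     (\<forall>j\<in>{1..k0}. \<bar>ucoef U b j\<bar> = \<sigma> j powr (1 + \<beta>)) \<and>
     (\<forall>j\<in>{k0<..n}. \<bar>ucoef U b j\<bar> = \<epsilon>) \<and>
     (\<forall>j\<in>{1..<n}. \<bar>ucoef U b (Suc j)\<bar> \<le> \<bar>ucoef U b j\<bar>) \<and>
     (\<forall>k\<in>{1..<n}. \<bar>ucoef U b (Suc k)\<bar> / \<bar>ucoef U b k\<bar> =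
        (if k \<le> k0 then (\<sigma> (Suc k) / \<sigma> k) powr (1 + \<beta>) else 1))"

end

theory Submission
  imports Defs "HOL-Analysis.L2_Norm" "HOL-Computational_Algebra.Polynomial"
    "Jordan_Normal_Form.Determinant"
begin

text \<open>
  Everything happens in singular coordinates \<open>c = V^T x\<close>, in which \<open>A\<close> is diagonal. There the span of
  \<open>q_1, ..., q_k\<close> consists of the vectors \<open>(f (\<sigma>_i^2) \<sigma>_i u_i^T b)_i\<close> with \<open>f\<close> a polynomial of degree
  below \<open>k\<close> (\<open>krylov_polys\<close>). Because \<open>\<sigma>_1, ..., \<sigma>_n\<close> are distinct and no \<open>u_i^T b\<close> vanishes, a nonzero
  polynomial of degree below \<open>n\<close> gives a nonzero vector. Hence the process does not break down for
  \<open>k < n\<close>, the \<open>p_j\<close> and \<open>q_j\<close> are orthonormal, and \<open>P_{k+1} B_k Q_k^T = A Q_k Q_k^T\<close>. So \<open>\<gamma>_k\<close> is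
  the norm of \<open>A\<close> on the orthogonal complement of the span of \<open>q_1, ..., q_k\<close>.

  This complement meets the \<open>(k+1)\<close>-dimensional span of the leading right singular vectors, on which
  \<open>A\<close> stretches by at least \<open>\<sigma>_{k+1}\<close>; this is the bound \<open>\<sigma>_{k+1} \<le> \<gamma>_k\<close> (\<open>gamma_ge_singular_value\<close>).
  For the upper bounds split \<open>c = (c1, c2)\<close> after the \<open>k\<close>-th coordinate. In
  \<open>\<parallel>A x\<parallel>^2 = \<parallel>\<Sigma>_k c1\<parallel>^2 + ...\<close> the part belonging to \<open>c2\<close> is at most \<open>\<sigma>_{k+1}^2 \<parallel>c2\<parallel>^2\<close>, so only
  \<open>\<Sigma>_k c1\<close> has to be controlled. A polynomial of degree below \<open>k\<close> is determined by its values at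
  \<open>\<sigma>_1^2, ..., \<sigma>_k^2\<close>, which means that the span of the \<open>q_j\<close> is the graph of \<open>\<Delta>_k\<close>; on the complement
  therefore \<open>c1 = - \<Delta>_k^T c2\<close>. Two estimates of \<open>\<Sigma>_k c1\<close> are used.

  \<^item> Solving the normal equations of the projection onto the graph expresses \<open>c1\<close> through the vector
    that was projected by the two matrices in the definition of \<open>\<eta>_k\<close>. This gives
    \<open>\<gamma>_k \<le> \<sigma>_{k+1} sqrt (1 + \<eta>_k^2)\<close> (\<open>gamma_le_eta\<close>), and with it the general criterion and the one for
    \<open>\<sigma>_k = \<zeta> k^{-\<alpha>}\<close>, where \<open>\<sigma>_k / \<sigma>_{k+1} = ((k+1)/k)^\<alpha>\<close> decreases in \<open>k\<close>.

  \<^item> If each singular value is at most half of its predecessor, the Picard model makes the entries of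
    \<open>\<Delta>_k\<close>, written with Lagrange polynomials, decay geometrically away from the corner at indices
    \<open>k + 1\<close> and \<open>k\<close>, so that \<open>\<parallel>\<Sigma>_k c1\<parallel> \<le> \<sigma>_{k+1} \<parallel>c2\<parallel>\<close> (\<open>orthogonal_head_le\<close>). Then
    \<open>\<gamma>_k \<le> sqrt 2 \<sigma>_{k+1} < 3/2 \<sigma>_{k+1} \<le> (\<sigma>_k + \<sigma>_{k+1}) / 2\<close> (\<open>gamma_le_sqrt2\<close>). This covers
    \<open>\<sigma>_k = \<zeta> \<rho>^{-k}\<close> with \<open>\<rho> > 2\<close>.
\<close>

section \<open>Euclidean and spectral norms\<close>

lemma norm2_vec_sq: "(norm2_vec x)\<^sup>2 = (\<Sum>i<dim_vec x. (x $ i)\<^sup>2)"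
  unfolding norm2_vec_def scalar_prod_def
  by (subst real_sqrt_pow2) (auto simp: sum_nonneg power2_eq_square lessThan_atLeast0)

lemma norm2_vec_sq_scalar_prod: "(norm2_vec x)\<^sup>2 = x \<bullet> x"
  unfolding norm2_vec_sq scalar_prod_def by (simp add: power2_eq_square lessThan_atLeast0)

lemma norm2_vec_nonneg [simp]: "0 \<le> norm2_vec x"
  by (simp add: norm2_vec_def scalar_prod_def sum_nonneg)

lemma norm2_vec_eq_L2_set: "norm2_vec x = L2_set (($) x) {..<dim_vec x}"
  by (metis L2_set_def norm2_vec_nonneg norm2_vec_sq real_sqrt_abs abs_of_nonneg)

lemma norm2_vec_smult: "norm2_vec (a \<cdot>\<^sub>v x) = \<bar>a\<bar> * norm2_vec x"
  by (simp add: norm2_vec_def real_sqrt_mult flip: mult.assoc power2_eq_square)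

lemma norm2_vec_eq_0_iff: "norm2_vec x = 0 \<longleftrightarrow> x = 0\<^sub>v (dim_vec x)"
proof -
  have "norm2_vec x = 0 \<longleftrightarrow> (\<Sum>i<dim_vec x. (x $ i)\<^sup>2) = 0"
    by (metis norm2_vec_sq power_zero_numeral zero_eq_power2)
  also have "\<dots> \<longleftrightarrow> (\<forall>i<dim_vec x. x $ i = 0)"
    by (subst sum_nonneg_eq_0_iff) auto
  also have "\<dots> \<longleftrightarrow> x = 0\<^sub>v (dim_vec x)"
    by (metis eq_vecI index_zero_vec)
  finally show ?thesis .
qed

lemma scalar_prod_Cauchy_Schwarz:
  assumes "dim_vec x = dim_vec y"
  shows "\<bar>x \<bullet> y\<bar> \<le> norm2_vec x * norm2_vec y"
proof -
  have "\<bar>x \<bullet> y\<bar> \<le> (\<Sum>i<dim_vec x. \<bar>x $ i\<bar> * \<bar>y $ i\<bar>)"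
    using assms by (auto simp: scalar_prod_def abs_mult lessThan_atLeast0 intro: order_trans[OF sum_abs])
  also have "\<dots> \<le> norm2_vec x * norm2_vec y"
    using assms L2_set_mult_ineq by (simp add: norm2_vec_eq_L2_set)
  finally show ?thesis .
qed

text \<open>
  The supremum that defines the spectral norm is finite because the Frobenius norm bounds it; without
  this fact the supremum would carry no information about individual vectors.
\<close>

lemma norm2_mat_bdd_above:
  "bdd_above {norm2_vec (M *\<^sub>v x) | x. x \<in> carrier_vec (dim_col M) \<and> norm2_vec x \<le> 1}"
proof (rule bdd_aboveI)
  fix y assume "y \<in> {norm2_vec (M *\<^sub>v x) | x. x \<in> carrier_vec (dim_col M) \<and> norm2_vec x \<le> 1}"
  then obtain x where x: "y = norm2_vec (M *\<^sub>v x)" "x \<in> carrier_vec (dim_col M)" "norm2_vec x \<le> 1"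
    by blast
  have "(norm2_vec (M *\<^sub>v x))\<^sup>2 \<le> (\<Sum>i<dim_row M. (norm2_vec (row M i))\<^sup>2)"
    unfolding norm2_vec_sq[of "M *\<^sub>v x"]
  proof (simp, rule sum_mono)
    fix i assume "i \<in> {..<dim_row M}"
    have "\<bar>row M i \<bullet> x\<bar> \<le> norm2_vec (row M i) * norm2_vec x"
      using x by (intro scalar_prod_Cauchy_Schwarz) auto
    also have "\<dots> \<le> norm2_vec (row M i)"
      using x by (simp add: mult_left_le)
    finally show "(row M i \<bullet> x)\<^sup>2 \<le> (norm2_vec (row M i))\<^sup>2"
      by (metis abs_ge_zero power2_abs power_mono)
  qed
  then show "y \<le> sqrt (\<Sum>i<dim_row M. (norm2_vec (row M i))\<^sup>2)"
    using x real_le_rsqrt by blast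
qed

lemma norm2_mat_le:
  assumes "\<And>x. x \<in> carrier_vec (dim_col M) \<Longrightarrow> norm2_vec x \<le> 1 \<Longrightarrow> norm2_vec (M *\<^sub>v x) \<le> C"
  shows "norm2_mat M \<le> C"
  unfolding norm2_mat_def
proof (rule cSup_least)
  have "norm2_vec (0\<^sub>v (dim_col M)) \<le> 1" by (simp add: norm2_vec_def)
  then show "{norm2_vec (M *\<^sub>v x) | x. x \<in> carrier_vec (dim_col M) \<and> norm2_vec x \<le> 1} \<noteq> {}"
    using zero_carrier_vec by blast
qed (use assms in blast)

lemma norm2_mat_bound:
  assumes M: "M \<in> carrier_mat nr nc" and x: "x \<in> carrier_vec nc"
  shows "norm2_vec (M *\<^sub>v x) \<le> norm2_mat M * norm2_vec x"
proof (cases "norm2_vec x = 0")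
  case True
  then have "x = 0\<^sub>v nc" using x norm2_vec_eq_0_iff[of x] by auto
  with M have "M *\<^sub>v x = 0\<^sub>v nr" by (intro eq_vecI) auto
  then show ?thesis using True by (simp add: norm2_vec_def)
next
  case False
  let ?N = "norm2_vec x"
  have pos: "0 < ?N" using False norm2_vec_nonneg[of x] by linarith
  have "norm2_vec (M *\<^sub>v ((1 / ?N) \<cdot>\<^sub>v x)) \<le> norm2_mat M"
    unfolding norm2_mat_def
  proof (rule cSup_upper[OF _ norm2_mat_bdd_above])
    have "norm2_vec ((1 / ?N) \<cdot>\<^sub>v x) \<le> 1" using pos by (simp add: norm2_vec_smult)
    then show "norm2_vec (M *\<^sub>v ((1 / ?N) \<cdot>\<^sub>v x))
      \<in> {norm2_vec (M *\<^sub>v x) | x. x \<in> carrier_vec (dim_col M) \<and> norm2_vec x \<le> 1}"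
      using M x by auto
  qed
  moreover have "M *\<^sub>v ((1 / ?N) \<cdot>\<^sub>v x) = (1 / ?N) \<cdot>\<^sub>v (M *\<^sub>v x)"
    using M x by (rule mult_mat_vec)
  ultimately show ?thesis using pos by (simp add: norm2_vec_smult field_simps)
qed

text \<open>
  The equation survives for \<open>x = 0\<close>, where the factor \<open>1 / norm2_vec x\<close> takes the default value 0.
  The Lanczos recurrences thus hold as identities whether or not a remainder vanishes.
\<close>

lemma norm2_vec_normalize:
  assumes "x \<in> carrier_vec N"
  shows "norm2_vec x \<cdot>\<^sub>v ((1 / norm2_vec x) \<cdot>\<^sub>v x) = x"
proof (cases "norm2_vec x = 0")
  case True
  then have "x = 0\<^sub>v N" using norm2_vec_eq_0_iff[of x] assms by simp
  then show ?thesis by auto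
next
  case False
  then show ?thesis by (simp add: smult_smult_assoc)
qed

lemma norm2_vec_normalized:
  assumes "norm2_vec x \<noteq> 0"
  shows "((1 / norm2_vec x) \<cdot>\<^sub>v x) \<bullet> ((1 / norm2_vec x) \<cdot>\<^sub>v x) = 1"
proof -
  have "x \<bullet> x \<noteq> 0" using assms by (metis norm2_vec_sq_scalar_prod zero_eq_power2)
  then show ?thesis
    using assms norm2_vec_sq_scalar_prod[of x] by (simp add: power2_eq_square field_simps)
qed

lemma norm2_vec_minus_le:
  assumes "dim_vec x = dim_vec y"
  shows "norm2_vec (x - y) \<le> norm2_vec x + norm2_vec y"
proof -
  have "norm2_vec (x - y) = L2_set (\<lambda>i. x $ i + (- y $ i)) {..<dim_vec y}"
    unfolding norm2_vec_eq_L2_set by (intro L2_set_cong) auto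
  also have "\<dots> \<le> L2_set (($) x) {..<dim_vec y} + L2_set (\<lambda>i. - y $ i) {..<dim_vec y}"
    by (rule L2_set_triangle_ineq)
  finally show ?thesis using assms by (simp add: norm2_vec_eq_L2_set L2_set_def)
qed

section \<open>Matrices and vectors\<close>

lemma mat_diag_mult_vec_index:
  fixes y :: "real vec"
  assumes "y \<in> carrier_vec N" "i < N"
  shows "(mat_diag N d *\<^sub>v y) $ i = d i * y $ i"
  using assms by (auto simp: mat_diag_def scalar_prod_def if_distrib[where f = "\<lambda>t. t * c" for c]
      sum.delta cong: if_cong)

lemma mat_unit_vec:
  fixes M :: "real mat"
  assumes "M \<in> carrier_mat r c" "i < c"
  shows "M *\<^sub>v unit_vec c i = col M i"
  using assms by (intro eq_vecI) auto

lemma transpose_mult_vec_isometry: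
  fixes Q :: "real mat"
  assumes Q: "Q \<in> carrier_mat N N" "Q\<^sup>T * Q = 1\<^sub>m N" and x: "x \<in> carrier_vec N" "y \<in> carrier_vec N"
  shows "(Q\<^sup>T *\<^sub>v x) \<bullet> (Q\<^sup>T *\<^sub>v y) = x \<bullet> y"
proof -
  have QQ: "Q * Q\<^sup>T = 1\<^sub>m N" using mat_mult_left_right_inverse[of "Q\<^sup>T" N Q] Q by simp
  have QT: "Q\<^sup>T \<in> carrier_mat N N" using Q by simp
  have "(Q\<^sup>T *\<^sub>v x) \<bullet> (Q\<^sup>T *\<^sub>v y) = x \<bullet> (Q *\<^sub>v (Q\<^sup>T *\<^sub>v y))"
    using transpose_vec_mult_scalar[OF QT, of "Q\<^sup>T *\<^sub>v y" x] transpose_vec_mult_scalar[OF Q(1), of "Q\<^sup>T *\<^sub>v y" x] QT x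
    by (metis carrier_vec_dim_vec comm_scalar_prod mult_mat_vec_carrier transpose_transpose Q(1))
  also have "Q *\<^sub>v (Q\<^sup>T *\<^sub>v y) = y" using assoc_mult_mat_vec[OF Q(1) QT x(2)] QQ x by simp
  finally show ?thesis .
qed

lemma injective_mat_minv:
  fixes M :: "real mat"
  assumes M: "M \<in> carrier_mat k k"
    and inj: "\<And>x. x \<in> carrier_vec k \<Longrightarrow> M *\<^sub>v x = 0\<^sub>v k \<Longrightarrow> x = 0\<^sub>v k"
  shows "minv M \<in> carrier_mat k k" "minv M * M = 1\<^sub>m k"
proof -
  have "det M \<noteq> 0" using det_0_iff_vec_prod_zero_field[OF M] inj by blast
  then have "mat_inverse M \<noteq> None"
    using det_non_zero_imp_unit[OF M, where b = "()"] mat_inverse(1)[OF M, where b = "()"] by blast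
  then obtain B where B: "mat_inverse M = Some B" by blast
  from mat_inverse(2)[OF M B] B
  show "minv M \<in> carrier_mat k k" "minv M * M = 1\<^sub>m k"
    by (auto simp: minv_def)
qed

lemma gram_plus_one_injective:
  fixes D :: "real mat"
  assumes D: "D \<in> carrier_mat l k" and x: "x \<in> carrier_vec k"
    and eq: "(1\<^sub>m k + D\<^sup>T * D) *\<^sub>v x = 0\<^sub>v k"
  shows "x = 0\<^sub>v k"
proof -
  have DT: "D\<^sup>T \<in> carrier_mat k l" using D by simp
  have Dx: "D *\<^sub>v x \<in> carrier_vec l" using D x by simp
  have "0 = x \<bullet> ((1\<^sub>m k + D\<^sup>T * D) *\<^sub>v x)" unfolding eq using x by simp
  also have "(1\<^sub>m k + D\<^sup>T * D) *\<^sub>v x = x + D\<^sup>T *\<^sub>v (D *\<^sub>v x)"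
    using D x by (subst add_mult_distrib_mat_vec[of _ k k]) (auto simp: assoc_mult_mat_vec[OF DT D])
  also have "x \<bullet> \<dots> = x \<bullet> x + x \<bullet> (D\<^sup>T *\<^sub>v (D *\<^sub>v x))"
    using x by (rule scalar_prod_add_distrib[of _ k]) (use x D in auto)
  also have "x \<bullet> (D\<^sup>T *\<^sub>v (D *\<^sub>v x)) = (D *\<^sub>v x) \<bullet> (D *\<^sub>v x)"
    using transpose_vec_mult_scalar[OF D x Dx] comm_scalar_prod[of x k "D\<^sup>T *\<^sub>v (D *\<^sub>v x)"] DT Dx x by simp
  finally have "x \<bullet> x = 0"
    using zero_le_power2[of "norm2_vec x"] zero_le_power2[of "norm2_vec (D *\<^sub>v x)"]
    unfolding norm2_vec_sq_scalar_prod by linarith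
  then show ?thesis using norm2_vec_eq_0_iff[of x] x by (simp add: norm2_vec_def)
qed

text \<open>
  The graph \<open>{(y, D y)}\<close> has orthogonal complement \<open>{(- D^T c2, c2)}\<close>, so \<open>(c1, c2)\<close> is the component
  of \<open>(w1, w2)\<close> orthogonal to the graph. The other component is \<open>(y, D y)\<close> with \<open>y = w1 - c1\<close> solving
  the normal equations \<open>(I + D^T D) y = w1 + D^T w2\<close>, and \<open>w1 = W (w1 + D^T D w1)\<close>.
\<close>

lemma graph_complement_projection:
  fixes D :: "real mat"
  assumes D: "D \<in> carrier_mat l k"
    and car: "w1 \<in> carrier_vec k" "c1 \<in> carrier_vec k" "w2 \<in> carrier_vec l" "c2 \<in> carrier_vec l"
    and graph: "w2 - c2 = D *\<^sub>v (w1 - c1)"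
    and orth: "c1 + D\<^sup>T *\<^sub>v c2 = 0\<^sub>v k"
  defines "W \<equiv> minv (1\<^sub>m k + D\<^sup>T * D)"
  shows "c1 = (W * D\<^sup>T * D) *\<^sub>v w1 - (W * D\<^sup>T) *\<^sub>v w2"
proof -
  define G where "G = 1\<^sub>m k + D\<^sup>T * D"
  have DT: "D\<^sup>T \<in> carrier_mat k l" and G: "G \<in> carrier_mat k k" using D by (auto simp: G_def)
  have W: "W \<in> carrier_mat k k" and WG: "W * G = 1\<^sub>m k"
    using injective_mat_minv[OF G] gram_plus_one_injective[OF D] unfolding W_def G_def by auto
  have Gv: "G *\<^sub>v x = x + D\<^sup>T *\<^sub>v (D *\<^sub>v x)" if "x \<in> carrier_vec k" for x
    unfolding G_def using D that
    by (subst add_mult_distrib_mat_vec[of _ k k]) (auto simp: assoc_mult_mat_vec[OF DT D])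
  have WGv: "W *\<^sub>v (G *\<^sub>v x) = x" if "x \<in> carrier_vec k" for x
    using assoc_mult_mat_vec[OF W G that] WG that by simp
  have "D\<^sup>T *\<^sub>v (D *\<^sub>v (w1 - c1)) = D\<^sup>T *\<^sub>v w2 - D\<^sup>T *\<^sub>v c2"
    unfolding graph[symmetric] using DT car by (simp add: mult_minus_distrib_mat_vec)
  then have "G *\<^sub>v (w1 - c1) = (w1 - c1) + (D\<^sup>T *\<^sub>v w2 - D\<^sup>T *\<^sub>v c2)"
    using Gv[of "w1 - c1"] car by simp
  also have "\<dots> = w1 + D\<^sup>T *\<^sub>v w2 - (c1 + D\<^sup>T *\<^sub>v c2)"
    using car DT D by (intro eq_vecI) auto
  also have "\<dots> = w1 + D\<^sup>T *\<^sub>v w2" using orth car DT by simp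
  finally have Gy: "G *\<^sub>v (w1 - c1) = w1 + D\<^sup>T *\<^sub>v w2" .
  have DDw: "D\<^sup>T *\<^sub>v (D *\<^sub>v w1) \<in> carrier_vec k" "D\<^sup>T *\<^sub>v w2 \<in> carrier_vec k" using D DT car by auto
  have "c1 = w1 - (w1 - c1)" using car by (intro eq_vecI) auto
  also have "\<dots> = W *\<^sub>v (G *\<^sub>v w1) - W *\<^sub>v (G *\<^sub>v (w1 - c1))" using car by (simp add: WGv)
  also have "\<dots> = W *\<^sub>v (G *\<^sub>v w1 - G *\<^sub>v (w1 - c1))"
    using mult_minus_distrib_mat_vec[OF W, of "G *\<^sub>v w1" "G *\<^sub>v (w1 - c1)"] G car by simp
  also have "G *\<^sub>v w1 - G *\<^sub>v (w1 - c1) = D\<^sup>T *\<^sub>v (D *\<^sub>v w1) - D\<^sup>T *\<^sub>v w2"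
    unfolding Gy Gv[OF car(1)] using DDw car DT by (intro eq_vecI) auto
  also have "W *\<^sub>v \<dots> = W *\<^sub>v (D\<^sup>T *\<^sub>v (D *\<^sub>v w1)) - W *\<^sub>v (D\<^sup>T *\<^sub>v w2)"
    using mult_minus_distrib_mat_vec[OF W DDw] .
  also have "W *\<^sub>v (D\<^sup>T *\<^sub>v (D *\<^sub>v w1)) = (W * D\<^sup>T * D) *\<^sub>v w1"
    by (simp only: assoc_mult_mat_vec[OF mult_carrier_mat[OF W DT] D car(1)]
        assoc_mult_mat_vec[OF W DT mult_mat_vec_carrier[OF D car(1)]])
  also have "W *\<^sub>v (D\<^sup>T *\<^sub>v w2) = (W * D\<^sup>T) *\<^sub>v w2"
    using W DT car by (simp add: assoc_mult_mat_vec[of _ k k])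
  finally show ?thesis .
qed

section \<open>Finite sums and products\<close>

lemma sum_lessThan_split:
  fixes F :: "nat \<Rightarrow> real"
  assumes "k \<le> n"
  shows "(\<Sum>i<n. F i) = (\<Sum>i<k. F i) + (\<Sum>i<n - k. F (k + i))"
proof -
  have "(\<Sum>i<k + d. F i) = (\<Sum>i<k. F i) + (\<Sum>i<d. F (k + i))" for d
    by (induction d) auto
  from this[of "n - k"] show ?thesis using assms by simp
qed

lemma poly_coeff_vec:
  fixes f :: "real poly"
  assumes "degree f < k"
  shows "(\<Sum>j<k. x ^ j * coeff f j) = poly f x"
proof -
  have "(\<Sum>j<k. x ^ j * coeff f j) = (\<Sum>j\<le>degree f. coeff f j * x ^ j)"
    using assms by (intro sum.mono_neutral_cong_right) (auto simp: coeff_eq_0)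
  then show ?thesis by (simp add: poly_altdef)
qed

text \<open>
  A Weierstrass product inequality, \<open>\<Prod> (1 - a_d) \<ge> 1 - \<Sum> a_d\<close> for \<open>a_d = 4^{-d}\<close>, \<open>1 \<le> d \<le> j\<close>. The
  summand \<open>4^{-j} / 3\<close> is what makes the bound inductive.
\<close>

lemma prod_one_minus_quarter_powers_ge:
  "2 / 3 + 1 / 3 * (1 / 4) ^ j \<le> (\<Prod>l<j. 1 - (1 / 4 :: real) ^ (j - l))"
proof (induction j)
  case (Suc j)
  let ?t = "(1 / 4 :: real) ^ j"
  have t: "0 \<le> ?t" "?t \<le> 1" by (auto intro: power_le_one)
  have "(1 - ?t / 4) * (2 / 3 + 1 / 3 * ?t) - (2 / 3 + 1 / 3 * (?t / 4)) = ?t * (1 - ?t) / 12"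
    by (simp add: field_simps)
  also have "\<dots> \<ge> 0" using t by simp
  finally have "2 / 3 + 1 / 3 * (?t / 4) \<le> (1 - ?t / 4) * (2 / 3 + 1 / 3 * ?t)" by simp
  also have "\<dots> \<le> (1 - ?t / 4) * (\<Prod>l<j. 1 - (1 / 4) ^ (j - l))"
    using Suc t by (intro mult_left_mono) auto
  also have "\<dots> = (\<Prod>l<Suc j. 1 - (1 / 4) ^ (Suc j - l))"
    by (subst prod.lessThan_Suc_shift) simp
  finally show ?case by simp
qed simp

lemma sum_quarter_powers: "(\<Sum>j<k. (1 / 4 :: real) ^ (k - j)) \<le> 1 / 3"
proof -
  have "(\<Sum>j<k. (1 / 4 :: real) ^ (k - j)) = (1 - (1 / 4) ^ k) / 3"
    by (induction k) (auto simp: sum.lessThan_Suc_shift simp del: sum.lessThan_Suc)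
  then show ?thesis by simp
qed

lemma sum_quarter_powers_up: "(\<Sum>i<d. (1 / 4 :: real) ^ i) \<le> 4 / 3"
proof -
  have "(\<Sum>i<d. (1 / 4 :: real) ^ i) = 4 / 3 * (1 - (1 / 4) ^ d)"
    by (induction d) auto
  then show ?thesis by simp
qed

section \<open>Golub-Kahan bidiagonalization\<close>

lemma lanczos_carrier:
  fixes A :: "real mat"
  assumes "A \<in> carrier_mat m n" "b \<in> carrier_vec m"
  shows "fst (snd (lanczos A b j)) \<in> carrier_vec n \<and> snd (snd (snd (lanczos A b j))) \<in> carrier_vec m"
  using assms by (induction j) (auto simp: Let_def split: prod.splits)

text \<open>
  The recursion counts steps, so the index of \<open>p\<close> and \<open>beta\<close> below is one less than customary: after
  \<open>j\<close> steps \<open>alpha j\<close>, \<open>q j\<close> are \<open>\<alpha>_j\<close>, \<open>q_j\<close>, whereas \<open>beta j\<close>, \<open>p j\<close> are \<open>\<beta>_{j+1}\<close>, \<open>p_{j+1}\<close>.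
\<close>

locale lanczos_process =
  fixes A :: "real mat" and b :: "real vec" and m n :: nat
  assumes A: "A \<in> carrier_mat m n" and b: "b \<in> carrier_vec m"
begin

definition alpha where "alpha j = fst (lanczos A b j)"
definition q where "q j = fst (snd (lanczos A b j))"
definition beta where "beta j = fst (snd (snd (lanczos A b j)))"
definition p where "p j = snd (snd (snd (lanczos A b j)))"

lemma q_carrier [simp]: "q j \<in> carrier_vec n" and p_carrier [simp]: "p j \<in> carrier_vec m"
  using lanczos_carrier[OF A b] by (auto simp: q_def p_def)

lemma q_dim [simp]: "dim_vec (q j) = n" and p_dim [simp]: "dim_vec (p j) = m"
  using q_carrier p_carrier by (auto simp del: q_carrier p_carrier dest: carrier_vecD)

lemma AT: "A\<^sup>T \<in> carrier_mat n m" using A by simp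

lemma ATp_carrier [simp]: "A\<^sup>T *\<^sub>v p j \<in> carrier_vec n"
  and Aq_carrier [simp]: "A *\<^sub>v q j \<in> carrier_vec m"
  using A AT by simp_all

lemma q_0: "q 0 = 0\<^sub>v n" and p_0: "p 0 = (1 / norm2_vec b) \<cdot>\<^sub>v b"
  using A by (auto simp: q_def p_def)

lemma alpha_Suc: "alpha (Suc j) = norm2_vec (A\<^sup>T *\<^sub>v p j - beta j \<cdot>\<^sub>v q j)"
  and q_Suc: "q (Suc j) = (1 / alpha (Suc j)) \<cdot>\<^sub>v (A\<^sup>T *\<^sub>v p j - beta j \<cdot>\<^sub>v q j)"
  and beta_Suc: "beta (Suc j) = norm2_vec (A *\<^sub>v q (Suc j) - alpha (Suc j) \<cdot>\<^sub>v p j)"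
  and p_Suc: "p (Suc j) = (1 / beta (Suc j)) \<cdot>\<^sub>v (A *\<^sub>v q (Suc j) - alpha (Suc j) \<cdot>\<^sub>v p j)"
  by (auto simp: alpha_def q_def beta_def p_def Let_def split: prod.splits)

lemma alpha_smult_q: "alpha (Suc j) \<cdot>\<^sub>v q (Suc j) = A\<^sup>T *\<^sub>v p j - beta j \<cdot>\<^sub>v q j"
  unfolding q_Suc alpha_Suc by (rule norm2_vec_normalize[of _ n]) simp

lemma beta_smult_p: "beta (Suc j) \<cdot>\<^sub>v p (Suc j) = A *\<^sub>v q (Suc j) - alpha (Suc j) \<cdot>\<^sub>v p j"
  unfolding p_Suc beta_Suc by (rule norm2_vec_normalize[of _ m]) simp

lemma ATp_eq: "A\<^sup>T *\<^sub>v p j = alpha (Suc j) \<cdot>\<^sub>v q (Suc j) + beta j \<cdot>\<^sub>v q j"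
  unfolding alpha_smult_q using AT by (intro eq_vecI) auto

lemma Aq_eq: "A *\<^sub>v q (Suc j) = alpha (Suc j) \<cdot>\<^sub>v p j + beta (Suc j) \<cdot>\<^sub>v p (Suc j)"
  unfolding beta_smult_p using A by (intro eq_vecI) auto

lemma ATp_q: "(A\<^sup>T *\<^sub>v p j) \<bullet> q i = p j \<bullet> (A *\<^sub>v q i)"
  using transpose_vec_mult_scalar[OF A, of "q i" "p j"] by simp

text \<open>
  The two recurrences are adjoint to each other: testing the one for \<open>q (k+1)\<close> against an earlier \<open>q i\<close>
  moves \<open>A\<close> onto \<open>q i\<close>, where the other recurrence expresses \<open>A q_i\<close> by at most two of the \<open>p\<close>, and
  symmetrically for \<open>p (k+1)\<close>. The clause \<open>i \<noteq> 0\<close> accounts for \<open>q_0 = 0\<close>.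
\<close>

lemma orthonormal:
  assumes "norm2_vec b \<noteq> 0" "\<And>i. 1 \<le> i \<Longrightarrow> i \<le> k \<Longrightarrow> alpha i \<noteq> 0 \<and> beta i \<noteq> 0"
  shows "(\<forall>i\<le>k. \<forall>j\<le>k. p i \<bullet> p j = (if i = j then 1 else 0))
    \<and> (\<forall>i\<le>k. \<forall>j\<le>k. q i \<bullet> q j = (if i = j \<and> i \<noteq> 0 then 1 else 0))"
  using assms(2)
proof (induction k)
  case 0
  have "p 0 \<bullet> p 0 = 1" unfolding p_0 by (rule norm2_vec_normalized[OF assms(1)])
  then show ?case by (simp add: q_0)
next
  case (Suc k)
  have IHp: "p i \<bullet> p j = (if i = j then 1 else 0)"
    and IHq: "q i \<bullet> q j = (if i = j \<and> i \<noteq> 0 then 1 else 0)" if "i \<le> k" "j \<le> k" for i j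
    using Suc that by auto
  have nz: "alpha (Suc k) \<noteq> 0" "beta (Suc k) \<noteq> 0" using Suc.prems[of "Suc k"] by auto
  have q1: "q (Suc k) \<bullet> q (Suc k) = 1"
    using nz(1) norm2_vec_normalized unfolding q_Suc alpha_Suc by blast
  have p1: "p (Suc k) \<bullet> p (Suc k) = 1"
    using nz(2) norm2_vec_normalized unfolding p_Suc beta_Suc by blast
  have q0: "q (Suc k) \<bullet> q i = 0" if "i \<le> k" for i
  proof (cases i)
    case 0
    then show ?thesis by (simp add: q_0)
  next
    case (Suc i')
    have "alpha (Suc k) * (q (Suc k) \<bullet> q i) = (alpha (Suc k) \<cdot>\<^sub>v q (Suc k)) \<bullet> q i" by simp
    also have "\<dots> = p k \<bullet> (A *\<^sub>v q i) - beta k * (q k \<bullet> q i)"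
      unfolding alpha_smult_q by (subst minus_scalar_prod_distrib[of _ n]) (auto simp: ATp_q)
    also have "p k \<bullet> (A *\<^sub>v q i) = alpha i * (p k \<bullet> p i') + beta i * (p k \<bullet> p i)"
      unfolding Suc Aq_eq by (subst scalar_prod_add_distrib[of _ m]) auto
    also have "\<dots> - beta k * (q k \<bullet> q i) = 0" using that Suc by (auto simp: IHp IHq)
    finally show ?thesis using nz by simp
  qed
  have p0: "p (Suc k) \<bullet> p i = 0" if "i \<le> k" for i
  proof -
    have "beta (Suc k) * (p (Suc k) \<bullet> p i) = (beta (Suc k) \<cdot>\<^sub>v p (Suc k)) \<bullet> p i" by simp
    also have "\<dots> = (A *\<^sub>v q (Suc k)) \<bullet> p i - alpha (Suc k) * (p k \<bullet> p i)"
      unfolding beta_smult_p by (subst minus_scalar_prod_distrib[of _ m]) auto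
    also have "(A *\<^sub>v q (Suc k)) \<bullet> p i = q (Suc k) \<bullet> (A\<^sup>T *\<^sub>v p i)"
      using ATp_q[of i "Suc k"] comm_scalar_prod[of "A *\<^sub>v q (Suc k)" m "p i"]
        comm_scalar_prod[of "A\<^sup>T *\<^sub>v p i" n "q (Suc k)"] by simp
    also have "\<dots> = alpha (Suc i) * (q (Suc k) \<bullet> q (Suc i)) + beta i * (q (Suc k) \<bullet> q i)"
      unfolding ATp_eq by (subst scalar_prod_add_distrib[of _ n]) auto
    also have "\<dots> - alpha (Suc k) * (p k \<bullet> p i) = 0"
      using that by (cases "i = k") (auto simp: IHp q0 q1)
    finally show ?thesis using nz by simp
  qed
  have q0': "q i \<bullet> q (Suc k) = 0" and p0': "p i \<bullet> p (Suc k) = 0" if "i \<le> k" for i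
    using q0[OF that] p0[OF that] comm_scalar_prod[of "q i" n "q (Suc k)"]
      comm_scalar_prod[of "p i" m "p (Suc k)"] by simp_all
  show ?case
    by (auto simp: le_Suc_eq IHp IHq q0 p0 q0' p0' p1 q1)
qed

lemma lanczos_Q_carrier [simp]: "lanczos_Q A b k \<in> carrier_mat n k"
  and lanczos_P_carrier [simp]: "lanczos_P A b k \<in> carrier_mat m k"
  using A by (auto simp: lanczos_Q_def lanczos_P_def)

lemma lanczos_QP_dims [simp]:
  "dim_row (lanczos_Q A b k) = n" "dim_col (lanczos_Q A b k) = k"
  "dim_row (lanczos_P A b k) = m" "dim_col (lanczos_P A b k) = k"
  using lanczos_Q_carrier[of k] lanczos_P_carrier[of k] by blast+

lemma col_lanczos_Q:
  assumes "i < k"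
  shows "col (lanczos_Q A b k) i = q (Suc i)"
proof -
  have "map (lanczos_q A b) [1..<Suc k] ! i = q (Suc i)"
    using assms by (simp add: lanczos_q_def q_def del: upt_Suc)
  then show ?thesis
    using assms A col_mat_of_cols[of i "map (lanczos_q A b) [1..<Suc k]" n]
    by (simp add: lanczos_Q_def del: upt_Suc)
qed

lemma col_lanczos_P:
  assumes "i < k"
  shows "col (lanczos_P A b k) i = p i"
proof -
  have "map (lanczos_p A b) [1..<Suc k] ! i = p i"
    using assms by (simp add: lanczos_p_def p_def del: upt_Suc)
  then show ?thesis
    using assms A col_mat_of_cols[of i "map (lanczos_p A b) [1..<Suc k]" m]
    by (simp add: lanczos_P_def del: upt_Suc)
qed

text \<open>
  \<open>P_{k+1} P_{k+1}^T\<close> projects onto the span of \<open>p_1, ..., p_{k+1}\<close>, which contains every \<open>A q_j\<close> with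
  \<open>j \<le> k\<close>. Hence \<open>P_{k+1} B_k = A Q_k\<close>.
\<close>

lemma lanczos_approx_mult_vec:
  assumes "norm2_vec b \<noteq> 0" "\<And>i. 1 \<le> i \<Longrightarrow> i \<le> k \<Longrightarrow> alpha i \<noteq> 0 \<and> beta i \<noteq> 0"
    and w: "w \<in> carrier_vec n"
  shows "lanczos_approx A b k *\<^sub>v w = A *\<^sub>v (lanczos_Q A b k *\<^sub>v ((lanczos_Q A b k)\<^sup>T *\<^sub>v w))"
proof -
  let ?Q = "lanczos_Q A b k" and ?P = "lanczos_P A b (Suc k)"
  note on = orthonormal[OF assms(1), of k, OF assms(2)]
  have cars: "?Q \<in> carrier_mat n k" "?P \<in> carrier_mat m (Suc k)" "?P\<^sup>T \<in> carrier_mat (Suc k) m"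
    "?Q\<^sup>T \<in> carrier_mat k n" "A * ?Q \<in> carrier_mat m k" using A by auto
  have PP: "?P\<^sup>T * ?P = 1\<^sub>m (Suc k)"
    using cars on by (intro eq_matI) (auto simp: col_lanczos_P)
  have Pp: "?P *\<^sub>v (?P\<^sup>T *\<^sub>v p i) = p i" if "i \<le> k" for i
  proof -
    have "p i = ?P *\<^sub>v unit_vec (Suc k) i"
      using that mat_unit_vec[OF cars(2)] by (simp add: col_lanczos_P)
    moreover have "?P\<^sup>T *\<^sub>v (?P *\<^sub>v unit_vec (Suc k) i) = unit_vec (Suc k) i"
      using assoc_mult_mat_vec[OF cars(3,2), of "unit_vec (Suc k) i"] PP by simp
    ultimately show ?thesis by simp
  qed
  have PAq: "?P *\<^sub>v (?P\<^sup>T *\<^sub>v (A *\<^sub>v q (Suc i))) = A *\<^sub>v q (Suc i)" if "i < k" for i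
  proof -
    have "?P\<^sup>T *\<^sub>v (A *\<^sub>v q (Suc i)) = alpha (Suc i) \<cdot>\<^sub>v (?P\<^sup>T *\<^sub>v p i) + beta (Suc i) \<cdot>\<^sub>v (?P\<^sup>T *\<^sub>v p (Suc i))"
      unfolding Aq_eq using cars
      by (subst mult_add_distrib_mat_vec[OF cars(3)]) (auto simp: mult_mat_vec[OF cars(3)])
    also have "?P *\<^sub>v \<dots> = alpha (Suc i) \<cdot>\<^sub>v (?P *\<^sub>v (?P\<^sup>T *\<^sub>v p i)) + beta (Suc i) \<cdot>\<^sub>v (?P *\<^sub>v (?P\<^sup>T *\<^sub>v p (Suc i)))"
      using mult_mat_vec_carrier[OF cars(3) p_carrier]
      by (subst mult_add_distrib_mat_vec[OF cars(2)]) (auto simp: mult_mat_vec[OF cars(2)] simp del: index_mult_mat_vec)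
    finally show ?thesis using that by (simp add: Pp Aq_eq)
  qed
  have PAQ: "?P * (?P\<^sup>T * (A * ?Q)) = A * ?Q"
  proof (rule mat_col_eqI)
    fix i assume "i < dim_col (A * ?Q)"
    then have i: "i < k" using cars by simp
    have "col (?P * (?P\<^sup>T * (A * ?Q))) i = ?P *\<^sub>v (?P\<^sup>T *\<^sub>v (A *\<^sub>v col ?Q i))"
      using i by (simp only: col_mult2[OF cars(2) mult_carrier_mat[OF cars(3,5)]]
          col_mult2[OF cars(3,5)] col_mult2[OF A cars(1)])
    also have "\<dots> = A *\<^sub>v col ?Q i" using i PAq by (simp add: col_lanczos_Q)
    finally show "col (?P * (?P\<^sup>T * (A * ?Q))) i = col (A * ?Q) i"
      using i by (simp only: col_mult2[OF A cars(1)])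
  qed (use cars A in auto)
  have "lanczos_approx A b k = ?P * (?P\<^sup>T * (A * ?Q)) * ?Q\<^sup>T"
    unfolding lanczos_approx_def lanczos_B_def using assoc_mult_mat[OF cars(3) A cars(1)] by simp
  then have "lanczos_approx A b k = (A * ?Q) * ?Q\<^sup>T" unfolding PAQ .
  then have "lanczos_approx A b k *\<^sub>v w = (A * ?Q) *\<^sub>v (?Q\<^sup>T *\<^sub>v w)"
    using assoc_mult_mat_vec[OF cars(5,4) w] by simp
  also have "\<dots> = A *\<^sub>v (?Q *\<^sub>v (?Q\<^sup>T *\<^sub>v w))"
    by (rule assoc_mult_mat_vec[OF A cars(1) mult_mat_vec_carrier[OF cars(4) w]])
  finally show ?thesis .
qed

end

section \<open>Krylov polynomials in singular coordinates\<close>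

text \<open>
  Zero-based copies \<open>s\<close> and \<open>u\<close> of the singular values and of the coefficients \<open>u_i^T b\<close> are used so
  that they share their indices with matrix and vector entries; in particular \<open>s k\<close> is \<open>\<sigma>_{k+1}\<close>.
\<close>

locale lanczos_svd = lanczos_process A b m n for A :: "real mat" and b :: "real vec" and m n :: nat +
  fixes U V :: "real mat" and \<sigma> :: "nat \<Rightarrow> real"
  assumes n_le_m: "n \<le> m" and svd: "is_svd m n A U \<sigma> V"
    and \<sigma>_dec: "\<forall>i\<in>{1..<n}. \<sigma> (Suc i) < \<sigma> i" and \<sigma>_pos: "\<sigma> n > 0"
    and ucoef_nz: "\<forall>i\<in>{1..n}. ucoef U b i \<noteq> 0"
    and n_pos: "0 < n"
begin

definition s where "s i = \<sigma> (Suc i)"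
definition u where "u i = ucoef U b (Suc i)"

lemma U: "U \<in> carrier_mat m m" and UU: "U\<^sup>T * U = 1\<^sub>m m"
  and V: "V \<in> carrier_mat n n" and VV: "V\<^sup>T * V = 1\<^sub>m n"
  and A_eq: "A = U * (mat_diag n s @\<^sub>r 0\<^sub>m (m - n) n) * V\<^sup>T"
  using svd by (auto simp: is_svd_def s_def[abs_def])

lemma UT: "U\<^sup>T \<in> carrier_mat m m" and VT: "V\<^sup>T \<in> carrier_mat n n" using U V by auto

lemma s_mono: "i < j \<Longrightarrow> j < n \<Longrightarrow> s j < s i"
proof (induction j)
  case (Suc j)
  have "s (Suc j) < s j" using Suc.prems \<sigma>_dec by (simp add: s_def)
  with Suc show ?case by (cases "i = j") auto
qed simp

lemma s_le: "i \<le> j \<Longrightarrow> j < n \<Longrightarrow> s j \<le> s i"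
  using s_mono[of i j] by (cases "i = j") auto

lemma s_pos:
  assumes "i < n"
  shows "0 < s i"
proof -
  have "s (n - 1) \<le> s i" using assms by (intro s_le) auto
  then show ?thesis using \<sigma>_pos n_pos by (simp add: s_def)
qed

lemma s_sq_inj: "i < n \<Longrightarrow> j < n \<Longrightarrow> (s i)\<^sup>2 = (s j)\<^sup>2 \<Longrightarrow> i = j"
  using s_mono[of i j] s_mono[of j i] s_pos[of i] s_pos[of j]
  by (metis less_irrefl less_imp_le linorder_neqE_nat power2_eq_iff_nonneg)

lemma u_nz: "i < n \<Longrightarrow> u i \<noteq> 0"
  using ucoef_nz by (simp add: u_def)

lemma UTb: "i < m \<Longrightarrow> (U\<^sup>T *\<^sub>v b) $ i = u i"
  using U by (simp add: u_def ucoef_def)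

definition Sig where "Sig = mat m n (\<lambda>(i, j). if i = j then s i else 0)"

lemma Sig: "Sig \<in> carrier_mat m n" and SigT: "Sig\<^sup>T \<in> carrier_mat n m" by (auto simp: Sig_def)

lemma Sig_mult:
  assumes "y \<in> carrier_vec n" "i < m"
  shows "(Sig *\<^sub>v y) $ i = (if i < n then s i * y $ i else 0)"
  using assms by (auto simp: Sig_def scalar_prod_def if_distrib[where f = "\<lambda>t. t * c" for c]
      sum.delta cong: if_cong)

lemma SigT_mult:
  assumes "y \<in> carrier_vec m" "i < n"
  shows "(Sig\<^sup>T *\<^sub>v y) $ i = s i * y $ i"
  using assms n_le_m by (auto simp: Sig_def scalar_prod_def if_distrib[where f = "\<lambda>t. t * c" for c]
      sum.delta cong: if_cong)

lemma A_eq_Sig: "A = U * Sig * V\<^sup>T"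
proof -
  have "mat_diag n s @\<^sub>r 0\<^sub>m (m - n) n = Sig"
    unfolding append_rows_def using n_le_m
    by (intro eq_matI) (auto simp: Sig_def mat_diag_def index_mat_four_block)
  then show ?thesis using A_eq by simp
qed

lemma UT_A:
  assumes x: "x \<in> carrier_vec n" and i: "i < m"
  shows "(U\<^sup>T *\<^sub>v (A *\<^sub>v x)) $ i = (if i < n then s i * (V\<^sup>T *\<^sub>v x) $ i else 0)"
proof -
  have y: "V\<^sup>T *\<^sub>v x \<in> carrier_vec n" using VT x by simp
  have "A *\<^sub>v x = U *\<^sub>v (Sig *\<^sub>v (V\<^sup>T *\<^sub>v x))"
    unfolding A_eq_Sig assoc_mult_mat_vec[OF mult_carrier_mat[OF U Sig] VT x]
    by (rule assoc_mult_mat_vec[OF U Sig y])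
  then have "U\<^sup>T *\<^sub>v (A *\<^sub>v x) = Sig *\<^sub>v (V\<^sup>T *\<^sub>v x)"
    using assoc_mult_mat_vec[OF UT U, of "Sig *\<^sub>v (V\<^sup>T *\<^sub>v x)"] UU Sig y by simp
  then show ?thesis using Sig_mult[OF y i] by simp
qed

lemma VT_AT:
  assumes y: "y \<in> carrier_vec m" and i: "i < n"
  shows "(V\<^sup>T *\<^sub>v (A\<^sup>T *\<^sub>v y)) $ i = s i * (U\<^sup>T *\<^sub>v y) $ i"
proof -
  have z: "U\<^sup>T *\<^sub>v y \<in> carrier_vec m" using UT y by simp
  have "A\<^sup>T = V * (Sig\<^sup>T * U\<^sup>T)"
    unfolding A_eq_Sig transpose_mult[OF mult_carrier_mat[OF U Sig] VT] transpose_mult[OF U Sig]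
    by simp
  then have "A\<^sup>T *\<^sub>v y = V *\<^sub>v (Sig\<^sup>T *\<^sub>v (U\<^sup>T *\<^sub>v y))"
    using assoc_mult_mat_vec[OF V mult_carrier_mat[OF SigT UT] y] assoc_mult_mat_vec[OF SigT UT y]
    by simp
  then have "V\<^sup>T *\<^sub>v (A\<^sup>T *\<^sub>v y) = Sig\<^sup>T *\<^sub>v (U\<^sup>T *\<^sub>v y)"
    using assoc_mult_mat_vec[OF VT V, of "Sig\<^sup>T *\<^sub>v (U\<^sup>T *\<^sub>v y)"] VV SigT z by simp
  then show ?thesis using SigT_mult[OF z i] by simp
qed

lemma norm_VT: "x \<in> carrier_vec n \<Longrightarrow> norm2_vec (V\<^sup>T *\<^sub>v x) = norm2_vec x"
  using transpose_mult_vec_isometry[OF V VV] by (simp add: norm2_vec_def)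

lemma norm_A_sq:
  assumes x: "x \<in> carrier_vec n"
  shows "(norm2_vec (A *\<^sub>v x))\<^sup>2 = (\<Sum>i<n. (s i * (V\<^sup>T *\<^sub>v x) $ i)\<^sup>2)"
proof -
  have Ax: "A *\<^sub>v x \<in> carrier_vec m" using A x by simp
  have "(norm2_vec (A *\<^sub>v x))\<^sup>2 = (norm2_vec (U\<^sup>T *\<^sub>v (A *\<^sub>v x)))\<^sup>2"
    using transpose_mult_vec_isometry[OF U UU Ax Ax] by (simp add: norm2_vec_def)
  also have "\<dots> = (\<Sum>i<m. (if i < n then s i * (V\<^sup>T *\<^sub>v x) $ i else 0)\<^sup>2)"
    unfolding norm2_vec_sq using U UT_A[OF x] by simp
  also have "\<dots> = (\<Sum>i<n. (s i * (V\<^sup>T *\<^sub>v x) $ i)\<^sup>2)"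
    using n_le_m by (intro sum.mono_neutral_cong_right) auto
  finally show ?thesis .
qed

text \<open>
  Distinct singular values give more interpolation nodes than a nonzero polynomial has roots. This
  excludes zero remainders in the Lanczos process and makes the Vandermonde matrix in the definition
  of \<open>\<Delta>_k\<close> nonsingular.
\<close>

lemma poly_singular_values_nz:
  assumes "degree h < k" "k \<le> n" "h \<noteq> 0"
  shows "\<exists>i<k. poly h ((s i)\<^sup>2) \<noteq> 0"
proof (rule ccontr)
  assume "\<not> ?thesis"
  then have "(\<lambda>i. (s i)\<^sup>2) ` {..<k} \<subseteq> {x. poly h x = 0}" by auto
  then have "card ((\<lambda>i. (s i)\<^sup>2) ` {..<k}) \<le> card {x. poly h x = 0}"
    using assms poly_roots_finite by (intro card_mono) auto
  also have "\<dots> \<le> degree h" using assms(3) by (rule card_poly_roots_bound)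
  also have "card ((\<lambda>i. (s i)\<^sup>2) ` {..<k}) = k"
    using s_sq_inj assms(2) by (subst card_image) (auto simp: inj_on_def)
  finally show False using assms by simp
qed

lemma norm_b_nz: "norm2_vec b \<noteq> 0"
proof
  assume "norm2_vec b = 0"
  then have "b = 0\<^sub>v m" using norm2_vec_eq_0_iff[of b] b by simp
  moreover have "col U 0 \<in> carrier_vec m" using U by (metis carrier_matD(1) col_dim)
  ultimately have "(U\<^sup>T *\<^sub>v b) $ 0 = 0" using U n_pos n_le_m by simp
  then show False using UTb[of 0] u_nz[of 0] n_pos n_le_m by simp
qed

lemma UT_b_poly: "i < n \<Longrightarrow> (U\<^sup>T *\<^sub>v p 0) $ i = poly [:1 / norm2_vec b:] ((s i)\<^sup>2) * u i"
  using UTb[of i] n_le_m b U by (simp add: p_0 mult_mat_vec[OF UT] del: index_mult_mat_vec)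

text \<open>
  \<open>q_j = f(A^T A) A^T b\<close> and \<open>p_{j+1} = g(A A^T) b\<close>, read in singular coordinates.
\<close>

definition krylov_q where
  "krylov_q j f \<longleftrightarrow> (\<forall>i<n. (V\<^sup>T *\<^sub>v q j) $ i = poly f ((s i)\<^sup>2) * s i * u i)"
definition krylov_p where
  "krylov_p j g \<longleftrightarrow> (\<forall>i<n. (U\<^sup>T *\<^sub>v p j) $ i = poly g ((s i)\<^sup>2) * u i)"

lemma index_VT_sub:
  "x \<in> carrier_vec n \<Longrightarrow> y \<in> carrier_vec n \<Longrightarrow> i < n \<Longrightarrow>
    (V\<^sup>T *\<^sub>v (x - c \<cdot>\<^sub>v y)) $ i = (V\<^sup>T *\<^sub>v x) $ i - c * (V\<^sup>T *\<^sub>v y) $ i"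
  using VT by (simp add: mult_minus_distrib_mat_vec[OF VT] mult_mat_vec[OF VT] del: index_mult_mat_vec)

lemma index_UT_sub:
  "x \<in> carrier_vec m \<Longrightarrow> y \<in> carrier_vec m \<Longrightarrow> i < m \<Longrightarrow>
    (U\<^sup>T *\<^sub>v (x - c \<cdot>\<^sub>v y)) $ i = (U\<^sup>T *\<^sub>v x) $ i - c * (U\<^sup>T *\<^sub>v y) $ i"
  using UT by (simp add: mult_minus_distrib_mat_vec[OF UT] mult_mat_vec[OF UT] del: index_mult_mat_vec)

text \<open>
  The remainder in the recurrence is again given by a polynomial, and its coefficient at \<open>j\<close> comes
  from \<open>g\<close> alone and is nonzero. Since \<open>j < n\<close>, such a polynomial cannot vanish at all \<open>\<sigma>_i^2\<close>.
\<close>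

lemma krylov_q_step:
  assumes f: "krylov_q j f" "degree f < j \<or> f = 0" and g: "krylov_p j g" "degree g \<le> j" "coeff g j \<noteq> 0"
    and j: "j < n"
  shows "alpha (Suc j) \<noteq> 0"
    and "\<exists>h. krylov_q (Suc j) h \<and> degree h \<le> j \<and> coeff h j \<noteq> 0"
proof -
  let ?r = "A\<^sup>T *\<^sub>v p j - beta j \<cdot>\<^sub>v q j" and ?h = "g - smult (beta j) f"
  have "coeff f j = 0" using f(2) coeff_eq_0 by auto
  then have h: "degree ?h \<le> j" "coeff ?h j \<noteq> 0"
    using f(2) g by (auto intro!: degree_diff_le order_trans[OF degree_smult_le])
  have r: "(V\<^sup>T *\<^sub>v ?r) $ i = poly ?h ((s i)\<^sup>2) * s i * u i" if i: "i < n" for i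
    using i f(1) g(1) by (subst index_VT_sub) (auto simp: krylov_q_def krylov_p_def VT_AT algebra_simps simp del: index_mult_mat_vec)
  obtain i where i: "i < n" "poly ?h ((s i)\<^sup>2) \<noteq> 0"
    using poly_singular_values_nz[of ?h n] h j by fastforce
  have "(V\<^sup>T *\<^sub>v ?r) $ i \<noteq> 0" using r i s_pos[of i] u_nz[of i] by simp
  then have "?r \<noteq> 0\<^sub>v n" using i V by auto
  then show alpha: "alpha (Suc j) \<noteq> 0"
    unfolding alpha_Suc using norm2_vec_eq_0_iff[of ?r] by simp
  let ?h' = "smult (1 / alpha (Suc j)) ?h"
  have "krylov_q (Suc j) ?h'"
    unfolding krylov_q_def q_Suc
    using V by (auto simp: mult_mat_vec[OF VT] r simp del: index_mult_mat_vec)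
  moreover have "degree ?h' \<le> j" "coeff ?h' j \<noteq> 0"
    using h alpha by (auto simp: degree_smult_eq)
  ultimately show "\<exists>h. krylov_q (Suc j) h \<and> degree h \<le> j \<and> coeff h j \<noteq> 0" by blast
qed

text \<open>
  Applying \<open>A\<close> multiplies the polynomial of \<open>q (j+1)\<close> by the variable and so raises the degree; this
  is why breakdown is only excluded for \<open>j + 1 < n\<close>.
\<close>

lemma krylov_p_step:
  assumes f: "krylov_q (Suc j) f" "degree f \<le> j" "coeff f j \<noteq> 0" and g: "krylov_p j g" "degree g \<le> j"
    and j: "Suc j < n"
  shows "beta (Suc j) \<noteq> 0"
    and "\<exists>h. krylov_p (Suc j) h \<and> degree h \<le> Suc j \<and> coeff h (Suc j) \<noteq> 0"
proof -
  let ?r = "A *\<^sub>v q (Suc j) - alpha (Suc j) \<cdot>\<^sub>v p j" and ?h = "pCons 0 f - smult (alpha (Suc j)) g"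
  have "coeff g (Suc j) = 0" using g(2) by (simp add: coeff_eq_0)
  then have h: "degree ?h \<le> Suc j" "coeff ?h (Suc j) \<noteq> 0"
    using f g by (auto intro!: degree_diff_le order_trans[OF degree_smult_le] order_trans[OF degree_pCons_le])
  have r: "(U\<^sup>T *\<^sub>v ?r) $ i = poly ?h ((s i)\<^sup>2) * u i" if i: "i < n" for i
    using i n_le_m f(1) g(1)
    by (subst index_UT_sub) (auto simp: krylov_q_def krylov_p_def UT_A algebra_simps power2_eq_square simp del: index_mult_mat_vec)
  obtain i where i: "i < n" "poly ?h ((s i)\<^sup>2) \<noteq> 0"
    using poly_singular_values_nz[of ?h n] h j by fastforce
  have "(U\<^sup>T *\<^sub>v ?r) $ i \<noteq> 0" using r i u_nz[of i] by simp
  then have "?r \<noteq> 0\<^sub>v m" using i U n_le_m by auto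
  then show beta: "beta (Suc j) \<noteq> 0"
    unfolding beta_Suc using norm2_vec_eq_0_iff[of ?r] by simp
  let ?h' = "smult (1 / beta (Suc j)) ?h"
  have "krylov_p (Suc j) ?h'"
    unfolding krylov_p_def p_Suc
    using U n_le_m by (auto simp: mult_mat_vec[OF UT] r simp del: index_mult_mat_vec)
  moreover have "degree ?h' \<le> Suc j" "coeff ?h' (Suc j) \<noteq> 0"
    using h beta by (auto simp: degree_smult_eq)
  ultimately show "\<exists>h. krylov_p (Suc j) h \<and> degree h \<le> Suc j \<and> coeff h (Suc j) \<noteq> 0" by blast
qed

lemma krylov_polys:
  "j < n \<Longrightarrow> (\<exists>g. krylov_p j g \<and> degree g \<le> j \<and> coeff g j \<noteq> 0)
    \<and> (\<exists>f. krylov_q j f \<and> (degree f < j \<or> f = 0) \<and> (0 < j \<longrightarrow> coeff f (j - 1) \<noteq> 0))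
    \<and> (0 < j \<longrightarrow> alpha j \<noteq> 0 \<and> beta j \<noteq> 0)"
proof (induction j)
  case 0
  have "krylov_p 0 [:1 / norm2_vec b:]" using UT_b_poly by (simp add: krylov_p_def)
  moreover have "krylov_q 0 0" using V by (simp add: krylov_q_def q_0)
  ultimately show ?case using norm_b_nz
    by (intro conjI exI[of _ "[:1 / norm2_vec b:]"] exI[of _ 0]) auto
next
  case (Suc j)
  then obtain g f where g: "krylov_p j g" "degree g \<le> j" "coeff g j \<noteq> 0"
    and f: "krylov_q j f" "degree f < j \<or> f = 0" by auto
  have j: "j < n" using Suc by simp
  obtain f' where f': "krylov_q (Suc j) f'" "degree f' \<le> j" "coeff f' j \<noteq> 0"
    using krylov_q_step(2)[OF f g j] by blast
  show ?case
    using krylov_q_step(1)[OF f g j] krylov_p_step[OF f' g(1,2) Suc.prems] f'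
    by (auto intro!: exI[of _ f'])
qed

lemma no_breakdown: "k < n \<Longrightarrow> 1 \<le> i \<Longrightarrow> i \<le> k \<Longrightarrow> alpha i \<noteq> 0 \<and> beta i \<noteq> 0"
  using krylov_polys[of i] by auto

lemma krylov_q_ex: "1 \<le> j \<Longrightarrow> j < n \<Longrightarrow> \<exists>f. krylov_q j f \<and> degree f < j \<and> coeff f (j - 1) \<noteq> 0"
  using krylov_polys[of j] by (metis One_nat_def Suc_le_eq coeff_0)

text \<open>
  The polynomials of \<open>q_1, ..., q_k\<close> have degrees exactly \<open>0, ..., k - 1\<close> and therefore span all
  polynomials of degree below \<open>k\<close>; leading terms are eliminated one after the other.
\<close>

lemma orthogonal_to_krylov:
  assumes x: "x \<in> carrier_vec n" and "k < n" and orth: "\<And>j. 1 \<le> j \<Longrightarrow> j \<le> k \<Longrightarrow> q j \<bullet> x = 0"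
    and h: "degree h < k"
  shows "(\<Sum>i<n. poly h ((s i)\<^sup>2) * s i * u i * (V\<^sup>T *\<^sub>v x) $ i) = 0"
  using assms(2-)
proof (induction k arbitrary: h)
  case 0
  then show ?case by simp
next
  case (Suc k)
  let ?\<phi> = "\<lambda>h. \<Sum>i<n. poly h ((s i)\<^sup>2) * s i * u i * (V\<^sup>T *\<^sub>v x) $ i"
  obtain f where f: "krylov_q (Suc k) f" "degree f < Suc k" "coeff f k \<noteq> 0"
    using krylov_q_ex[of "Suc k"] Suc.prems by auto
  have "?\<phi> f = (V\<^sup>T *\<^sub>v q (Suc k)) \<bullet> (V\<^sup>T *\<^sub>v x)"
    using f(1) V by (auto simp: krylov_q_def scalar_prod_def[of "_ :: real vec" "V\<^sup>T *\<^sub>v x"] lessThan_atLeast0 intro!: sum.cong simp del: index_mult_mat_vec)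
  also have "\<dots> = 0" using transpose_mult_vec_isometry[OF V VV q_carrier x] Suc.prems by simp
  finally have f0: "?\<phi> f = 0" .
  let ?c = "coeff h k / coeff f k"
  let ?d = "h - smult ?c f"
  have d0: "?\<phi> ?d = 0"
  proof (cases "?d = 0")
    case False
    have "degree ?d \<le> k" using f(2) Suc.prems(3)
      by (intro degree_diff_le order_trans[OF degree_smult_le]) auto
    moreover have "coeff ?d k = 0" using f(3) by simp
    ultimately have "degree ?d < k" using False
      by (metis leading_coeff_0_iff le_neq_implies_less)
    then show ?thesis using Suc.IH[of ?d] Suc.prems by simp
  qed simp
  have "?\<phi> h = ?\<phi> ?d + ?c * ?\<phi> f"
    unfolding sum_distrib_left sum.distrib[symmetric]
    by (intro sum.cong) (auto simp: algebra_simps)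
  then show ?case using d0 f0 by simp
qed

section \<open>The residual of the Lanczos approximation\<close>

lemma approx_carrier: "lanczos_approx A b k \<in> carrier_mat m n"
  by (simp add: lanczos_approx_def lanczos_B_def carrier_matI)

lemma lanczos_Q_T_mult: "i < k \<Longrightarrow> ((lanczos_Q A b k)\<^sup>T *\<^sub>v x) $ i = q (Suc i) \<bullet> x"
  by (simp add: col_lanczos_Q)

text \<open>
  The residual acts on \<open>w\<close> as \<open>A\<close> acts on \<open>x = w - Q_k Q_k^T w\<close>. The polynomial \<open>f\<close> describes the
  removed component \<open>Q_k Q_k^T w\<close>.
\<close>

lemma lanczos_residual:
  assumes k: "1 \<le> k" "k < n" and w: "w \<in> carrier_vec n"
  obtains x f where "x \<in> carrier_vec n" "norm2_vec x \<le> norm2_vec w"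
    "(A - lanczos_approx A b k) *\<^sub>v w = A *\<^sub>v x"
    "\<And>j. 1 \<le> j \<Longrightarrow> j \<le> k \<Longrightarrow> q j \<bullet> x = 0"
    "degree f < k"
    "\<And>i. i < n \<Longrightarrow> (V\<^sup>T *\<^sub>v w) $ i - (V\<^sup>T *\<^sub>v x) $ i = poly f ((s i)\<^sup>2) * s i * u i"
proof -
  let ?Q = "lanczos_Q A b k"
  have Q: "?Q \<in> carrier_mat n k" and QT: "?Q\<^sup>T \<in> carrier_mat k n" by auto
  define z where "z = ?Q\<^sup>T *\<^sub>v w"
  define x where "x = w - ?Q *\<^sub>v z"
  have z: "z \<in> carrier_vec k" using mult_mat_vec_carrier[OF QT w] by (simp add: z_def)
  have Qz: "?Q *\<^sub>v z \<in> carrier_vec n" using Q z by (rule mult_mat_vec_carrier)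
  have x: "x \<in> carrier_vec n" using w Qz by (simp add: x_def)
  have QQ: "?Q\<^sup>T * ?Q = 1\<^sub>m k"
    using orthonormal[OF norm_b_nz no_breakdown[OF k(2)]]
    by (intro eq_matI) (auto simp: col_lanczos_Q)
  have "?Q\<^sup>T *\<^sub>v x = ?Q\<^sup>T *\<^sub>v w - ?Q\<^sup>T *\<^sub>v (?Q *\<^sub>v z)"
    unfolding x_def using QT w Qz by (rule mult_minus_distrib_mat_vec)
  also have "?Q\<^sup>T *\<^sub>v (?Q *\<^sub>v z) = z" using assoc_mult_mat_vec[OF QT Q z] QQ z by simp
  finally have QTx: "?Q\<^sup>T *\<^sub>v x = 0\<^sub>v k" using z by (simp flip: z_def)
  have orth: "q j \<bullet> x = 0" if "1 \<le> j" "j \<le> k" for j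
    using lanczos_Q_T_mult[of "j - 1" k x] that QTx by simp
  have "(?Q *\<^sub>v z) \<bullet> x = 0"
    using transpose_vec_mult_scalar[OF Q z x] QTx z comm_scalar_prod[OF x Qz] by simp
  then have "x \<bullet> x = w \<bullet> x"
    by (subst (1) x_def) (simp add: minus_scalar_prod_distrib[OF w Qz x])
  then have "norm2_vec x * norm2_vec x \<le> norm2_vec w * norm2_vec x"
    using scalar_prod_Cauchy_Schwarz[of w x] w x norm2_vec_sq_scalar_prod[of x]
    by (simp add: power2_eq_square)
  then have nx: "norm2_vec x \<le> norm2_vec w"
    by (metis mult_right_le_imp_le norm2_vec_nonneg order_le_less)
  have "(A - lanczos_approx A b k) *\<^sub>v w = A *\<^sub>v w - A *\<^sub>v (?Q *\<^sub>v z)"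
    using lanczos_approx_mult_vec[OF norm_b_nz no_breakdown[OF k(2)] w]
      minus_mult_distrib_mat_vec[OF A approx_carrier w] by (simp add: z_def)
  also have "\<dots> = A *\<^sub>v x"
    unfolding x_def using mult_minus_distrib_mat_vec[OF A w Qz] by simp
  finally have Ax: "(A - lanczos_approx A b k) *\<^sub>v w = A *\<^sub>v x" .
  have "\<exists>f. krylov_q (Suc j) f \<and> degree f < k" if "j < k" for j
    using krylov_q_ex[of "Suc j"] that k(2) by fastforce
  then obtain F where F: "\<And>j. j < k \<Longrightarrow> krylov_q (Suc j) (F j) \<and> degree (F j) < k" by metis
  define f where "f = (\<Sum>j<k. smult (z $ j) (F j))"
  have "degree f < k"
    unfolding f_def using F k by (intro degree_sum_less) (auto intro: le_less_trans[OF degree_smult_le])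
  moreover have "(V\<^sup>T *\<^sub>v w) $ i - (V\<^sup>T *\<^sub>v x) $ i = poly f ((s i)\<^sup>2) * s i * u i" if i: "i < n" for i
  proof -
    have "(V\<^sup>T *\<^sub>v w) $ i - (V\<^sup>T *\<^sub>v x) $ i = (V\<^sup>T *\<^sub>v (?Q *\<^sub>v z)) $ i"
      using i V mult_minus_distrib_mat_vec[OF VT w Qz] by (simp add: x_def del: index_mult_mat_vec)
    also have "V\<^sup>T *\<^sub>v (?Q *\<^sub>v z) = (V\<^sup>T * ?Q) *\<^sub>v z" using assoc_mult_mat_vec[OF VT Q z] by simp
    also have "\<dots> $ i = (\<Sum>j<k. (V\<^sup>T *\<^sub>v q (Suc j)) $ i * z $ j)"
      using i V z by (auto simp: scalar_prod_def[of _ z] lessThan_atLeast0 col_lanczos_Q intro!: sum.cong)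
    also have "\<dots> = poly f ((s i)\<^sup>2) * s i * u i"
      using i F by (auto simp: f_def poly_sum sum_distrib_right krylov_q_def intro!: sum.cong simp del: index_mult_mat_vec)
    finally show ?thesis .
  qed
  ultimately show thesis using that x nx Ax orth by blast
qed

text \<open>
  The \<open>k\<close> conditions \<open>q_j \<bullet> x = 0\<close> leave a nonzero \<open>x\<close> in the span of \<open>v_1, ..., v_{k+1}\<close>. The
  approximation annihilates it, while \<open>\<parallel>A x\<parallel> \<ge> \<sigma>_{k+1} \<parallel>x\<parallel>\<close>.
\<close>

lemma gamma_ge_singular_value:
  assumes k: "1 \<le> k" "k < n"
  shows "s k \<le> gamma A b k"
proof -
  let ?Q = "lanczos_Q A b k"
  define M where "M = mat (Suc k) (Suc k) (\<lambda>(i, j). if i < k then (V\<^sup>T *\<^sub>v q (Suc i)) $ j else 0)"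
  have M: "M \<in> carrier_mat (Suc k) (Suc k)" by (simp add: M_def)
  \<comment> \<open>The \<open>k\<close> conditions in \<open>k + 1\<close> unknowns are padded by a zero row to a singular square matrix.\<close>
  have "M\<^sup>T *\<^sub>v unit_vec (Suc k) k = 0\<^sub>v (Suc k)"
    by (intro eq_vecI) (auto simp: M_def)
  moreover have "unit_vec (Suc k) k \<noteq> (0\<^sub>v (Suc k) :: real vec)" by simp
  ultimately have "det (M\<^sup>T) = 0"
    using det_0_iff_vec_prod_zero_field[of "M\<^sup>T" "Suc k"] M by (metis transpose_carrier_mat unit_vec_carrier)
  then have "det M = 0" using det_transpose[OF M] by simp
  then obtain a where a: "a \<in> carrier_vec (Suc k)" "a \<noteq> 0\<^sub>v (Suc k)" "M *\<^sub>v a = 0\<^sub>v (Suc k)"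
    using det_0_iff_vec_prod_zero_field[OF M] by blast
  define c where "c = vec n (\<lambda>i. if i \<le> k then a $ i else 0)"
  define x where "x = V *\<^sub>v c"
  have c: "c \<in> carrier_vec n" and x: "x \<in> carrier_vec n" using V by (auto simp: c_def x_def)
  have VTx: "V\<^sup>T *\<^sub>v x = c" unfolding x_def using assoc_mult_mat_vec[OF VT V c] VV c by simp
  have "q (Suc i) \<bullet> x = 0" if i: "i < k" for i
  proof -
    have "q (Suc i) \<bullet> x = (V\<^sup>T *\<^sub>v q (Suc i)) \<bullet> c"
      using transpose_mult_vec_isometry[OF V VV q_carrier x] VTx by simp
    also have "\<dots> = (\<Sum>j<n. if j \<le> k then (V\<^sup>T *\<^sub>v q (Suc i)) $ j * a $ j else 0)"
      unfolding scalar_prod_def[of _ c]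
      by (auto simp: c_def lessThan_atLeast0 intro!: sum.cong simp del: index_mult_mat_vec)
    also have "\<dots> = (\<Sum>j<Suc k. (V\<^sup>T *\<^sub>v q (Suc i)) $ j * a $ j)"
      using k by (intro sum.mono_neutral_cong_right) auto
    also have "\<dots> = (M *\<^sub>v a) $ i"
      using i a(1) by (auto simp: M_def scalar_prod_def[of _ a] lessThan_atLeast0 intro!: sum.cong simp del: sum.lessThan_Suc sum.op_ivl_Suc)
    also have "\<dots> = 0" using i a(3) by simp
    finally show ?thesis .
  qed
  then have "?Q\<^sup>T *\<^sub>v x = 0\<^sub>v k" by (intro eq_vecI) (auto simp: lanczos_Q_T_mult simp del: index_mult_mat_vec)
  then have "lanczos_approx A b k *\<^sub>v x = A *\<^sub>v (?Q *\<^sub>v 0\<^sub>v k)"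
    using lanczos_approx_mult_vec[OF norm_b_nz no_breakdown[OF k(2)] x] by simp
  also have "?Q *\<^sub>v 0\<^sub>v k = 0\<^sub>v n" by (intro eq_vecI) auto
  also have "A *\<^sub>v 0\<^sub>v n = 0\<^sub>v m" using A by (intro eq_vecI) auto
  finally have "(A - lanczos_approx A b k) *\<^sub>v x = A *\<^sub>v x"
    using minus_mult_distrib_mat_vec[OF A approx_carrier x] A x by simp
  then have ub: "norm2_vec (A *\<^sub>v x) \<le> gamma A b k * norm2_vec x"
    using norm2_mat_bound[OF minus_carrier_mat[OF approx_carrier] x] unfolding gamma_def by metis
  have nx: "(norm2_vec x)\<^sup>2 = (\<Sum>i<n. (c $ i)\<^sup>2)"
    using norm_VT[OF x] c unfolding VTx by (metis norm2_vec_sq carrier_vecD)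
  have "(s k * norm2_vec x)\<^sup>2 \<le> (norm2_vec (A *\<^sub>v x))\<^sup>2"
    unfolding norm_A_sq[OF x] VTx power_mult_distrib nx sum_distrib_left
  proof (rule sum_mono)
    fix i assume i: "i \<in> {..<n}"
    show "(s k)\<^sup>2 * (c $ i)\<^sup>2 \<le> (s i)\<^sup>2 * (c $ i)\<^sup>2"
    proof (cases "i \<le> k")
      case True
      then have "(s k)\<^sup>2 \<le> (s i)\<^sup>2" using s_le[of i k] s_pos[of k] k by (intro power_mono) auto
      then show ?thesis by (rule mult_right_mono) simp
    next
      case False
      then show ?thesis using i by (simp add: c_def)
    qed
  qed
  then have "s k * norm2_vec x \<le> gamma A b k * norm2_vec x"
    using ub by (meson norm2_vec_nonneg order_trans power2_le_imp_le)
  moreover have "norm2_vec x \<noteq> 0"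
  proof
    assume "norm2_vec x = 0"
    then have "c = 0\<^sub>v n" using norm_VT[OF x] VTx norm2_vec_eq_0_iff[of c] c by simp
    then have "c $ i = 0" if "i \<le> k" for i using that k by simp
    then have "a = 0\<^sub>v (Suc k)" using a(1) k by (intro eq_vecI) (auto simp: c_def)
    then show False using a(2) by simp
  qed
  ultimately show ?thesis
    using norm2_vec_nonneg[of x] by (simp add: mult_le_cancel_right order_less_le)
qed

lemma norm_A_sq_le_split:
  assumes x: "x \<in> carrier_vec n" and k: "k < n"
  shows "(norm2_vec (A *\<^sub>v x))\<^sup>2 \<le> (\<Sum>i<k. (s i * (V\<^sup>T *\<^sub>v x) $ i)\<^sup>2)
    + (s k)\<^sup>2 * (\<Sum>i<n - k. ((V\<^sup>T *\<^sub>v x) $ (k + i))\<^sup>2)"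
proof -
  have "(\<Sum>i<n - k. (s (k + i) * (V\<^sup>T *\<^sub>v x) $ (k + i))\<^sup>2)
      \<le> (\<Sum>i<n - k. (s k)\<^sup>2 * ((V\<^sup>T *\<^sub>v x) $ (k + i))\<^sup>2)"
  proof (rule sum_mono)
    fix i assume "i \<in> {..<n - k}"
    then have "k + i < n" by simp
    then have "(s (k + i))\<^sup>2 \<le> (s k)\<^sup>2"
      using s_le[of k "k + i"] s_pos[of "k + i"] by (intro power_mono) auto
    then show "(s (k + i) * (V\<^sup>T *\<^sub>v x) $ (k + i))\<^sup>2 \<le> (s k)\<^sup>2 * ((V\<^sup>T *\<^sub>v x) $ (k + i))\<^sup>2"
      unfolding power_mult_distrib by (rule mult_right_mono) simp
  qed
  then show ?thesis
    unfolding norm_A_sq[OF x] using k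
    by (subst sum_lessThan_split[of k n]) (auto simp: sum_distrib_left simp del: index_mult_mat_vec)
qed

lemma sum_tail_le_norm:
  assumes x: "x \<in> carrier_vec n" and k: "k < n"
  shows "(\<Sum>i<n - k. ((V\<^sup>T *\<^sub>v x) $ (k + i))\<^sup>2) \<le> (norm2_vec x)\<^sup>2"
proof -
  have "(norm2_vec x)\<^sup>2 = (\<Sum>i<n. ((V\<^sup>T *\<^sub>v x) $ i)\<^sup>2)"
    using norm_VT[OF x] V norm2_vec_sq[of "V\<^sup>T *\<^sub>v x"] by (simp del: index_mult_mat_vec)
  then show ?thesis
    using k sum_nonneg[of "{..<k}" "\<lambda>i. ((V\<^sup>T *\<^sub>v x) $ i)\<^sup>2"]
    by (subst (asm) sum_lessThan_split[of k n]) (auto simp del: index_mult_mat_vec)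
qed

section \<open>Lagrange polynomials, \<open>\<Delta>_k\<close> and the bound by \<open>\<eta>_k\<close>\<close>

text \<open>
  Lagrange basis polynomials for the nodes \<open>\<sigma>_1^2, ..., \<sigma>_k^2\<close>, left unnormalized: the value at the
  own node is nonzero instead of 1.
\<close>

definition lagrange :: "nat \<Rightarrow> nat \<Rightarrow> real poly" where
  "lagrange k j = (\<Prod>l\<in>{..<k} - {j}. [:- (s l)\<^sup>2, 1:])"

lemma poly_lagrange: "poly (lagrange k j) x = (\<Prod>l\<in>{..<k} - {j}. x - (s l)\<^sup>2)"
  by (simp add: lagrange_def poly_prod)

lemma degree_lagrange:
  assumes "j < k"
  shows "degree (lagrange k j) < k"
proof -
  have "degree (lagrange k j) \<le> sum (degree \<circ> (\<lambda>l. [:- (s l)\<^sup>2, 1:])) ({..<k} - {j})"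
    unfolding lagrange_def by (rule degree_prod_sum_le) simp
  also have "\<dots> = k - 1" using assms by simp
  finally show ?thesis using assms by simp
qed

lemma lagrange_other: "l < k \<Longrightarrow> l \<noteq> j \<Longrightarrow> poly (lagrange k j) ((s l)\<^sup>2) = 0"
  by (auto simp: poly_lagrange intro!: prod_zero)

lemma lagrange_self_nz:
  assumes "j < k" "k \<le> n"
  shows "poly (lagrange k j) ((s j)\<^sup>2) \<noteq> 0"
proof -
  have "(s j)\<^sup>2 \<noteq> (s l)\<^sup>2" if "l < k" "l \<noteq> j" for l using s_sq_inj[of j l] that assms by auto
  then show ?thesis by (simp add: poly_lagrange)
qed

text \<open>
  Orthogonality to the Krylov vector of a Lagrange polynomial involves only one of the first \<open>k\<close>
  coordinates, and so expresses that coordinate by the trailing ones. This is \<open>c1 = - \<Delta>_k^T c2\<close>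
  entry by entry.
\<close>

lemma lagrange_orthogonal:
  assumes x: "x \<in> carrier_vec n" and k: "k < n" "j < k"
    and orth: "\<And>j. 1 \<le> j \<Longrightarrow> j \<le> k \<Longrightarrow> q j \<bullet> x = 0"
  defines "L \<equiv> lagrange k j"
  shows "poly L ((s j)\<^sup>2) * s j * u j * (V\<^sup>T *\<^sub>v x) $ j =
    - (\<Sum>i<n - k. poly L ((s (k + i))\<^sup>2) * s (k + i) * u (k + i) * (V\<^sup>T *\<^sub>v x) $ (k + i))"
proof -
  let ?F = "\<lambda>i. poly L ((s i)\<^sup>2) * s i * u i * (V\<^sup>T *\<^sub>v x) $ i"
  have "0 = (\<Sum>i<n. ?F i)"
    using orthogonal_to_krylov[OF x k(1) orth degree_lagrange[OF k(2)]] by (simp add: L_def)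
  also have "\<dots> = (\<Sum>i<k. ?F i) + (\<Sum>i<n - k. ?F (k + i))"
    using k by (intro sum_lessThan_split) simp
  also have "(\<Sum>i<k. ?F i) = (\<Sum>i\<in>{j}. ?F i)"
    using k by (intro sum.mono_neutral_right) (auto simp: L_def lagrange_other)
  finally show ?thesis by (simp del: index_mult_mat_vec)
qed

text \<open>
  The span of \<open>q_1, ..., q_k\<close> is the graph of \<open>\<Delta>_k\<close>: with \<open>a\<close> the coefficient vector of \<open>f\<close>, the leading
  and the trailing coordinates of the Krylov vector of \<open>f\<close> are \<open>D_1 T_{k1} a\<close> and \<open>D_2 T_{k2} a\<close>.
\<close>

lemma Delta_carrier:
  assumes k: "k < n"
  shows "Delta n U \<sigma> b k \<in> carrier_mat (n - k) k"
    and Delta_poly: "degree f < k \<Longrightarrow>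
      Delta n U \<sigma> b k *\<^sub>v vec k (\<lambda>i. poly f ((s i)\<^sup>2) * s i * u i) =
      vec (n - k) (\<lambda>i. poly f ((s (k + i))\<^sup>2) * s (k + i) * u (k + i))"
proof -
  define T1 where "T1 = mat k k (\<lambda>(i, j). T_mat n \<sigma> k $$ (i, j))"
  define T2 where "T2 = mat (n - k) k (\<lambda>(i, j). T_mat n \<sigma> k $$ (k + i, j))"
  define D1 where "D1 = mat k k (\<lambda>(i, j). D_mat n U \<sigma> b $$ (i, j))"
  define D2 where "D2 = mat (n - k) (n - k) (\<lambda>(i, j). D_mat n U \<sigma> b $$ (k + i, k + j))"
  have Delta: "Delta n U \<sigma> b k = D2 * T2 * minv T1 * minv D1"
    by (simp add: Delta_def Let_def T1_def T2_def D1_def D2_def)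
  have T1: "T1 \<in> carrier_mat k k" and T2: "T2 \<in> carrier_mat (n - k) k"
    and D1: "D1 \<in> carrier_mat k k" and D2: "D2 \<in> carrier_mat (n - k) (n - k)"
    by (auto simp: T1_def T2_def D1_def D2_def)
  have T1_eq: "T1 = mat k k (\<lambda>(i, j). ((s i)\<^sup>2) ^ j)"
    and T2_eq: "T2 = mat (n - k) k (\<lambda>(i, j). ((s (k + i))\<^sup>2) ^ j)"
    using k by (auto simp: T1_def T2_def T_mat_def s_def power_mult intro!: eq_matI)
  have D1_eq: "D1 = mat_diag k (\<lambda>i. s i * u i)"
    and D2_eq: "D2 = mat_diag (n - k) (\<lambda>i. s (k + i) * u (k + i))"
    using k by (auto simp: D1_def D2_def D_mat_def s_def u_def mat_diag_def intro!: eq_matI)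
  have T1_poly: "(T1 *\<^sub>v vec k (coeff f)) $ i = poly f ((s i)\<^sup>2)" if "degree f < k" "i < k" for f i
    using that by (simp add: T1_eq scalar_prod_def poly_coeff_vec flip: lessThan_atLeast0)
  have T2_poly: "(T2 *\<^sub>v vec k (coeff f)) $ i = poly f ((s (k + i))\<^sup>2)" if "degree f < k" "i < n - k" for f i
    using that by (simp add: T2_eq scalar_prod_def poly_coeff_vec flip: lessThan_atLeast0)
  have T1_inj: "y = 0\<^sub>v k" if y: "y \<in> carrier_vec k" "T1 *\<^sub>v y = 0\<^sub>v k" for y
  proof (cases "k = 0")
    case True
    then show ?thesis using y by auto
  next
    case False
    define f where "f = (\<Sum>j<k. monom (y $ j) j)"
    have cf: "coeff f j = (if j < k then y $ j else 0)" for j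
      by (simp add: f_def coeff_sum if_distrib sum.delta cong: if_cong)
    have df: "degree f < k"
      unfolding f_def using False by (intro degree_sum_less) (auto intro: le_less_trans[OF degree_monom_le])
    have yf: "y = vec k (coeff f)" using y(1) by (intro eq_vecI) (auto simp: cf)
    have "poly f ((s i)\<^sup>2) = 0" if "i < k" for i
      using T1_poly[OF df that] y(2) that by (simp flip: yf)
    then have "f = 0" using poly_singular_values_nz[of f k] df k by auto
    then show ?thesis unfolding yf by (intro eq_vecI) auto
  qed
  have D1_inj: "y = 0\<^sub>v k" if y: "y \<in> carrier_vec k" "D1 *\<^sub>v y = 0\<^sub>v k" for y
  proof (intro eq_vecI)
    fix i assume "i < dim_vec (0\<^sub>v k :: real vec)"
    then have i: "i < k" by simp
    have "s i * u i * y $ i = (D1 *\<^sub>v y) $ i" unfolding D1_eq by (rule mat_diag_mult_vec_index[OF y(1) i, symmetric])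
    then have "s i * u i * y $ i = 0" using y(2) i by simp
    then show "y $ i = 0\<^sub>v k $ i" using s_pos[of i] u_nz[of i] i k by simp
  qed (use y in simp)
  note iT = injective_mat_minv[OF T1 T1_inj] and iD = injective_mat_minv[OF D1 D1_inj]
  have DT: "D2 * T2 \<in> carrier_mat (n - k) k" and DTi: "D2 * T2 * minv T1 \<in> carrier_mat (n - k) k"
    using D2 T2 iT by (auto intro!: mult_carrier_mat)
  show "Delta n U \<sigma> b k \<in> carrier_mat (n - k) k"
    unfolding Delta using DTi iD(1) by (rule mult_carrier_mat)
  assume f: "degree f < k"
  let ?a = "vec k (coeff f)"
  have a: "?a \<in> carrier_vec k" by simp
  have Ta: "T1 *\<^sub>v ?a \<in> carrier_vec k" and T2a: "T2 *\<^sub>v ?a \<in> carrier_vec (n - k)"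
    using T1 T2 by (auto intro!: mult_mat_vec_carrier)
  have DTa: "D1 *\<^sub>v (T1 *\<^sub>v ?a) \<in> carrier_vec k" using D1 Ta by (rule mult_mat_vec_carrier)
  have e1: "vec k (\<lambda>i. poly f ((s i)\<^sup>2) * s i * u i) = D1 *\<^sub>v (T1 *\<^sub>v ?a)"
  proof (intro eq_vecI)
    fix i assume "i < dim_vec (D1 *\<^sub>v (T1 *\<^sub>v ?a))"
    then have i: "i < k" using D1 by simp
    show "vec k (\<lambda>i. poly f ((s i)\<^sup>2) * s i * u i) $ i = (D1 *\<^sub>v (T1 *\<^sub>v ?a)) $ i"
      unfolding D1_eq mat_diag_mult_vec_index[OF Ta i] T1_poly[OF f i] using i by simp
  qed (use D1 in simp)
  have e2: "vec (n - k) (\<lambda>i. poly f ((s (k + i))\<^sup>2) * s (k + i) * u (k + i)) = D2 *\<^sub>v (T2 *\<^sub>v ?a)"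
  proof (intro eq_vecI)
    fix i assume "i < dim_vec (D2 *\<^sub>v (T2 *\<^sub>v ?a))"
    then have i: "i < n - k" using D2 by simp
    show "vec (n - k) (\<lambda>i. poly f ((s (k + i))\<^sup>2) * s (k + i) * u (k + i)) $ i = (D2 *\<^sub>v (T2 *\<^sub>v ?a)) $ i"
      unfolding D2_eq mat_diag_mult_vec_index[OF T2a i] T2_poly[OF f i] using i by simp
  qed (use D2 in simp)
  have "Delta n U \<sigma> b k *\<^sub>v (D1 *\<^sub>v (T1 *\<^sub>v ?a)) = (D2 * T2 * minv T1) *\<^sub>v (minv D1 *\<^sub>v (D1 *\<^sub>v (T1 *\<^sub>v ?a)))"
    unfolding Delta using DTi iD(1) DTa by (rule assoc_mult_mat_vec)
  also have "minv D1 *\<^sub>v (D1 *\<^sub>v (T1 *\<^sub>v ?a)) = T1 *\<^sub>v ?a"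
    using assoc_mult_mat_vec[OF iD(1) D1 Ta] iD(2) Ta by simp
  also have "(D2 * T2 * minv T1) *\<^sub>v (T1 *\<^sub>v ?a) = (D2 * T2) *\<^sub>v (minv T1 *\<^sub>v (T1 *\<^sub>v ?a))"
    using DT iT(1) Ta by (rule assoc_mult_mat_vec)
  also have "minv T1 *\<^sub>v (T1 *\<^sub>v ?a) = ?a"
    using assoc_mult_mat_vec[OF iT(1) T1 a] iT(2) by simp
  also have "(D2 * T2) *\<^sub>v ?a = D2 *\<^sub>v (T2 *\<^sub>v ?a)" using D2 T2 a by (rule assoc_mult_mat_vec)
  finally show "Delta n U \<sigma> b k *\<^sub>v vec k (\<lambda>i. poly f ((s i)\<^sup>2) * s i * u i) =
      vec (n - k) (\<lambda>i. poly f ((s (k + i))\<^sup>2) * s (k + i) * u (k + i))"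
    unfolding e1 e2 .
qed

text \<open>
  The complement of the graph of \<open>\<Delta>_k\<close>. Each coordinate is tested separately by a Lagrange polynomial,
  whose Krylov vector has a multiple of a unit vector as its leading part.
\<close>

lemma Delta_orthogonal:
  assumes x: "x \<in> carrier_vec n" and k: "k < n"
    and orth: "\<And>j. 1 \<le> j \<Longrightarrow> j \<le> k \<Longrightarrow> q j \<bullet> x = 0"
  defines "c \<equiv> V\<^sup>T *\<^sub>v x"
  shows "vec k (($) c) + (Delta n U \<sigma> b k)\<^sup>T *\<^sub>v vec (n - k) (\<lambda>i. c $ (k + i)) = 0\<^sub>v k"
proof -
  let ?D = "Delta n U \<sigma> b k" and ?c1 = "vec k (($) c)" and ?c2 = "vec (n - k) (\<lambda>i. c $ (k + i))"
  note D = Delta_carrier(1)[OF k]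
  have DT: "?D\<^sup>T \<in> carrier_mat k (n - k)" using D by simp
  show ?thesis
  proof (intro eq_vecI)
    fix j assume "j < dim_vec (0\<^sub>v k :: real vec)"
    then have j: "j < k" by simp
    let ?L = "lagrange k j"
    let ?t = "poly ?L ((s j)\<^sup>2) * s j * u j"
    let ?e = "vec k (\<lambda>i. poly ?L ((s i)\<^sup>2) * s i * u i)"
    have e: "?e = ?t \<cdot>\<^sub>v unit_vec k j"
      by (intro eq_vecI) (auto simp: unit_vec_def lagrange_other)
    have "?t * (?D\<^sup>T *\<^sub>v ?c2) $ j = (?D\<^sup>T *\<^sub>v ?c2) \<bullet> ?e"
      unfolding e using mult_mat_vec_carrier[OF DT, of ?c2] j by simp
    also have "\<dots> = ?c2 \<bullet> (?D *\<^sub>v ?e)"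
      by (rule transpose_vec_mult_scalar[OF D]) auto
    also have "\<dots> = (\<Sum>i<n - k. poly ?L ((s (k + i))\<^sup>2) * s (k + i) * u (k + i) * c $ (k + i))"
      unfolding Delta_poly[OF k degree_lagrange[OF j]]
      by (auto simp: scalar_prod_def lessThan_atLeast0 mult_ac intro!: sum.cong)
    also have "\<dots> = - (?t * c $ j)"
      unfolding c_def using lagrange_orthogonal[OF x k j orth] by (simp del: index_mult_mat_vec)
    finally have "?t * ((?D\<^sup>T *\<^sub>v ?c2) $ j + c $ j) = 0" by (simp add: distrib_left)
    moreover have "?t \<noteq> 0" using lagrange_self_nz[OF j] s_pos[of j] u_nz[of j] j k by simp
    ultimately have "(?D\<^sup>T *\<^sub>v ?c2) $ j + c $ j = 0" by simp
    then show "(?c1 + ?D\<^sup>T *\<^sub>v ?c2) $ j = 0\<^sub>v k $ j"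
      using j DT by (simp add: add.commute del: index_mult_mat_vec)
  qed (use DT in simp)
qed

text \<open>
  The projection formula writes \<open>\<Sigma>_k c1\<close> as \<open>M1 w1 - M2 w2\<close> with the two matrices \<open>M1\<close>, \<open>M2\<close> whose
  squared norms add up to \<open>\<eta>_k^2 \<sigma>_{k+1}^2\<close>, and \<open>\<parallel>w1\<parallel>^2 + \<parallel>w2\<parallel>^2 = \<parallel>w\<parallel>^2\<close>.
\<close>

lemma gamma_le_eta:
  assumes k: "1 \<le> k" "k < n"
  shows "gamma A b k \<le> s k * sqrt (1 + (eta n U \<sigma> b k)\<^sup>2)"
  unfolding gamma_def
proof (rule norm2_mat_le)
  fix w assume "w \<in> carrier_vec (dim_col (A - lanczos_approx A b k))" and w1: "norm2_vec w \<le> 1"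
  then have w: "w \<in> carrier_vec n" using approx_carrier[of k] by simp
  obtain x f where x: "x \<in> carrier_vec n" "norm2_vec x \<le> norm2_vec w"
    and Ax: "(A - lanczos_approx A b k) *\<^sub>v w = A *\<^sub>v x"
    and orth: "\<And>j. 1 \<le> j \<Longrightarrow> j \<le> k \<Longrightarrow> q j \<bullet> x = 0"
    and f: "degree f < k"
      "\<And>i. i < n \<Longrightarrow> (V\<^sup>T *\<^sub>v w) $ i - (V\<^sup>T *\<^sub>v x) $ i = poly f ((s i)\<^sup>2) * s i * u i"
    using lanczos_residual[OF k w] by metis
  let ?D = "Delta n U \<sigma> b k"
  let ?W = "minv (1\<^sub>m k + ?D\<^sup>T * ?D)"
  let ?S = "mat_diag k s"
  let ?w = "V\<^sup>T *\<^sub>v w" and ?c = "V\<^sup>T *\<^sub>v x"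
  define y1 where "y1 = vec k (($) ?w)"
  define y2 where "y2 = vec (n - k) (\<lambda>i. ?w $ (k + i))"
  define c1 where "c1 = vec k (($) ?c)"
  define c2 where "c2 = vec (n - k) (\<lambda>i. ?c $ (k + i))"
  have car: "y1 \<in> carrier_vec k" "c1 \<in> carrier_vec k" "y2 \<in> carrier_vec (n - k)" "c2 \<in> carrier_vec (n - k)"
    by (auto simp: y1_def y2_def c1_def c2_def)
  note D = Delta_carrier(1)[OF k(2)]
  have DT: "?D\<^sup>T \<in> carrier_mat k (n - k)" using D by simp
  have S: "?S \<in> carrier_mat k k" by simp
  have G: "1\<^sub>m k + ?D\<^sup>T * ?D \<in> carrier_mat k k" using D by simp
  have W: "?W \<in> carrier_mat k k"
    using injective_mat_minv(1)[OF G] gram_plus_one_injective[OF D] by blast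
  have "y1 - c1 = vec k (\<lambda>i. poly f ((s i)\<^sup>2) * s i * u i)"
    "y2 - c2 = vec (n - k) (\<lambda>i. poly f ((s (k + i))\<^sup>2) * s (k + i) * u (k + i))"
    using k f(2) by (auto simp: y1_def y2_def c1_def c2_def simp del: index_mult_mat_vec intro!: eq_vecI)
  then have graph: "y2 - c2 = ?D *\<^sub>v (y1 - c1)"
    using Delta_poly[OF k(2) f(1)] by simp
  have c1_eq: "c1 = (?W * ?D\<^sup>T * ?D) *\<^sub>v y1 - (?W * ?D\<^sup>T) *\<^sub>v y2"
    using graph_complement_projection[OF D car graph] Delta_orthogonal[OF x(1) k(2) orth]
    by (simp add: c1_def c2_def)
  have WD: "?W * ?D\<^sup>T \<in> carrier_mat k (n - k)" "?W * ?D\<^sup>T * ?D \<in> carrier_mat k k"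
    using mult_carrier_mat[OF W DT] mult_carrier_mat[OF mult_carrier_mat[OF W DT] D] by auto
  let ?M1 = "?S * ?W * ?D\<^sup>T * ?D" and ?M2 = "?S * ?W * ?D\<^sup>T"
  have M1: "?M1 = ?S * (?W * ?D\<^sup>T * ?D)" and M2: "?M2 = ?S * (?W * ?D\<^sup>T)"
    using assoc_mult_mat[OF S W DT] assoc_mult_mat[OF S WD(1) D] by simp_all
  have Mc1: "?M1 \<in> carrier_mat k k" unfolding M1 by (rule mult_carrier_mat[OF S WD(2)])
  have Mc2: "?M2 \<in> carrier_mat k (n - k)" unfolding M2 by (rule mult_carrier_mat[OF S WD(1)])
  note Mc = Mc1 Mc2
  have "?M1 *\<^sub>v y1 = ?S *\<^sub>v ((?W * ?D\<^sup>T * ?D) *\<^sub>v y1)"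
    unfolding M1 by (rule assoc_mult_mat_vec[OF S WD(2) car(1)])
  moreover have "?M2 *\<^sub>v y2 = ?S *\<^sub>v ((?W * ?D\<^sup>T) *\<^sub>v y2)"
    unfolding M2 by (rule assoc_mult_mat_vec[OF S WD(1) car(3)])
  ultimately have "?S *\<^sub>v c1 = ?M1 *\<^sub>v y1 - ?M2 *\<^sub>v y2"
    using mult_minus_distrib_mat_vec[OF S mult_mat_vec_carrier[OF WD(2) car(1)]
        mult_mat_vec_carrier[OF WD(1) car(3)]] c1_eq by simp
  then have "norm2_vec (?S *\<^sub>v c1) \<le> norm2_vec (?M1 *\<^sub>v y1) + norm2_vec (?M2 *\<^sub>v y2)"
    using norm2_vec_minus_le[of "?M1 *\<^sub>v y1" "?M2 *\<^sub>v y2"] Mc by simp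
  also have "\<dots> \<le> norm2_mat ?M1 * norm2_vec y1 + norm2_mat ?M2 * norm2_vec y2"
    using norm2_mat_bound[OF Mc(1) car(1)] norm2_mat_bound[OF Mc(2) car(3)] by simp
  finally have "(norm2_vec (?S *\<^sub>v c1))\<^sup>2 \<le> (norm2_mat ?M1 * norm2_vec y1 + norm2_mat ?M2 * norm2_vec y2)\<^sup>2"
    by (intro power_mono) auto
  also have "\<dots> \<le> ((norm2_mat ?M1)\<^sup>2 + (norm2_mat ?M2)\<^sup>2) * ((norm2_vec y1)\<^sup>2 + (norm2_vec y2)\<^sup>2)"
    using zero_le_power2[of "norm2_mat ?M1 * norm2_vec y2 - norm2_mat ?M2 * norm2_vec y1"]
    by (simp add: power2_eq_square algebra_simps)
  also have "(norm2_vec y1)\<^sup>2 + (norm2_vec y2)\<^sup>2 = (norm2_vec ?w)\<^sup>2"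
    unfolding norm2_vec_sq[of ?w] using V k sum_lessThan_split[of k n "\<lambda>i. (?w $ i)\<^sup>2"]
    by (simp add: norm2_vec_sq y1_def y2_def del: index_mult_mat_vec)
  also have "(norm2_mat ?M1)\<^sup>2 + (norm2_mat ?M2)\<^sup>2 = eta_rhs n U \<sigma> b k"
    by (simp add: eta_rhs_def Let_def s_def[abs_def])
  also have "eta_rhs n U \<sigma> b k * (norm2_vec ?w)\<^sup>2 \<le> eta_rhs n U \<sigma> b k"
    unfolding norm_VT[OF w] using w1 eta_rhs_nonneg by (intro mult_left_le) (auto simp: power_le_one)
  finally have top: "(norm2_vec (?S *\<^sub>v c1))\<^sup>2 \<le> eta_rhs n U \<sigma> b k" .
  have Sc: "(?S *\<^sub>v c1) $ i = s i * ?c $ i" if "i < k" for i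
    using mat_diag_mult_vec_index[OF car(2) that, of s] that by (simp add: c1_def del: index_mult_mat_vec)
  have "(\<Sum>i<k. (s i * ?c $ i)\<^sup>2) = (norm2_vec (?S *\<^sub>v c1))\<^sup>2"
    unfolding norm2_vec_sq using Sc by (simp add: mat_diag_def del: index_mult_mat_vec(1))
  with top have "(\<Sum>i<k. (s i * ?c $ i)\<^sup>2) \<le> (eta n U \<sigma> b k)\<^sup>2 * (s k)\<^sup>2"
    using eta_characterization[of \<sigma> k "eta n U \<sigma> b k" n U b] s_pos[of k] k by (simp add: s_def)
  moreover have "(s k)\<^sup>2 * (\<Sum>i<n - k. (?c $ (k + i))\<^sup>2) \<le> (s k)\<^sup>2"
    using sum_tail_le_norm[OF x(1) k(2)] x(2) w1
    by (intro mult_left_le) (auto intro: order_trans simp: power_le_one simp del: index_mult_mat_vec)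
  ultimately have "(norm2_vec (A *\<^sub>v x))\<^sup>2 \<le> (s k)\<^sup>2 * (1 + (eta n U \<sigma> b k)\<^sup>2)"
    using norm_A_sq_le_split[OF x(1) k(2)] by (simp add: algebra_simps del: index_mult_mat_vec)
  then have "norm2_vec (A *\<^sub>v x) \<le> sqrt ((s k)\<^sup>2 * (1 + (eta n U \<sigma> b k)\<^sup>2))"
    by (rule real_le_rsqrt)
  then show "norm2_vec ((A - lanczos_approx A b k) *\<^sub>v w) \<le> s k * sqrt (1 + (eta n U \<sigma> b k)\<^sup>2)"
    unfolding Ax using s_pos[of k] k by (simp add: real_sqrt_mult)
qed

section \<open>Singular values that at least halve\<close>

lemma halving_power:
  assumes half: "\<And>i. Suc i < n \<Longrightarrow> 2 * s (Suc i) \<le> s i"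
  shows "i + d < n \<Longrightarrow> s (i + d) \<le> (1 / 2) ^ d * s i"
proof (induction d)
  case (Suc d)
  then show ?case using half[of "i + d"] by simp
qed simp

text \<open>
  Compare the factors for each node \<open>(s l)^2\<close> with \<open>l \<noteq> j\<close>. The factor on the left is at most
  \<open>(s l)^2\<close>. On the right, a node with \<open>l > j\<close> contributes at least \<open>3 (s l)^2\<close>, and one with
  \<open>l < j\<close> at least \<open>(1 - 4^{-(j-l)}) (s l)^2\<close>; the product of the latter factors stays above \<open>2/3\<close>.
\<close>

lemma lagrange_ratio_le:
  assumes half: "\<And>i. Suc i < n \<Longrightarrow> 2 * s (Suc i) \<le> s i"
    and j: "j < k" "k \<le> i" "i < n"
  shows "\<bar>poly (lagrange k j) ((s i)\<^sup>2)\<bar> \<le> 3 / 2 * \<bar>poly (lagrange k j) ((s j)\<^sup>2)\<bar>"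
proof -
  let ?a = "\<lambda>l. \<bar>(s i)\<^sup>2 - (s l)\<^sup>2\<bar>" and ?b = "\<lambda>l. \<bar>(s j)\<^sup>2 - (s l)\<^sup>2\<bar>"
  let ?w = "\<lambda>l. 1 - (1 / 4 :: real) ^ (j - l)"
  have quarter: "(s (l + d))\<^sup>2 \<le> (1 / 4) ^ d * (s l)\<^sup>2" if "l + d < n" for l d
  proof -
    have "(s (l + d))\<^sup>2 \<le> ((1 / 2) ^ d * s l)\<^sup>2"
      using halving_power[OF half that] s_pos[OF that] by (intro power_mono) auto
    also have "((1 / 2) ^ d * s l)\<^sup>2 = (1 / 4) ^ d * (s l)\<^sup>2"
      by (simp add: power_mult_distrib power2_eq_square flip: power_mult_distrib mult.assoc)
    finally show ?thesis .
  qed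
  have a_le: "?a l \<le> (s l)\<^sup>2" if "l < k" for l
  proof -
    have "(s i)\<^sup>2 \<le> (s l)\<^sup>2" using that j s_le[of l i] s_pos[of i] by (intro power_mono) auto
    then show ?thesis by simp
  qed
  have left: "?a l * ?w l \<le> ?b l" if "l < j" for l
  proof -
    have "(s j)\<^sup>2 \<le> (1 / 4) ^ (j - l) * (s l)\<^sup>2" using quarter[of l "j - l"] that j by simp
    moreover have "?a l * ?w l \<le> (s l)\<^sup>2 * ?w l"
      using a_le[of l] that j by (intro mult_right_mono) (auto simp: power_le_one)
    ultimately show ?thesis by (simp add: algebra_simps)
  qed
  have right: "?a l \<le> ?b l" if "j < l" "l < k" for l
  proof -
    have "(1 / 4 :: real) ^ (l - j) \<le> (1 / 4) ^ 1" using that by (intro power_decreasing) auto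
    then have "(s l)\<^sup>2 \<le> 1 / 4 * (s j)\<^sup>2"
      using quarter[of j "l - j"] that j mult_right_mono[of "(1 / 4) ^ (l - j)" "1 / 4" "(s j)\<^sup>2"] by simp
    then show ?thesis using a_le[OF that(2)] by linarith
  qed
  have split: "{..<k} - {j} = {..<j} \<union> {j<..<k}" using j by auto
  have abs_lag: "\<bar>poly (lagrange k j) x\<bar> =
      (\<Prod>l<j. \<bar>x - (s l)\<^sup>2\<bar>) * (\<Prod>l\<in>{j<..<k}. \<bar>x - (s l)\<^sup>2\<bar>)" for x
    unfolding poly_lagrange abs_prod split by (rule prod.union_disjoint) auto
  have "(0 :: real) \<le> 1 / 3 * (1 / 4) ^ j" by simp
  then have w: "2 / 3 \<le> (\<Prod>l<j. ?w l)"
    using prod_one_minus_quarter_powers_ge[of j] by linarith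
  have "(\<Prod>l<j. ?a l) * (2 / 3) \<le> (\<Prod>l<j. ?a l) * (\<Prod>l<j. ?w l)"
    using w by (intro mult_left_mono prod_nonneg) auto
  also have "\<dots> = (\<Prod>l<j. ?a l * ?w l)" by (simp add: prod.distrib)
  also have "\<dots> \<le> (\<Prod>l<j. ?b l)"
    using left by (intro prod_mono) (auto intro!: mult_nonneg_nonneg simp: power_le_one)
  finally have "(\<Prod>l<j. ?a l) \<le> 3 / 2 * (\<Prod>l<j. ?b l)" by simp
  moreover have "(\<Prod>l\<in>{j<..<k}. ?a l) \<le> (\<Prod>l\<in>{j<..<k}. ?b l)"
    using right by (intro prod_mono) auto
  ultimately have "(\<Prod>l<j. ?a l) * (\<Prod>l\<in>{j<..<k}. ?a l)
      \<le> (3 / 2 * (\<Prod>l<j. ?b l)) * (\<Prod>l\<in>{j<..<k}. ?b l)"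
    by (intro mult_mono mult_nonneg_nonneg prod_nonneg) auto
  then show ?thesis unfolding abs_lag by simp
qed

text \<open>
  By \<open>lagrange_orthogonal\<close> and the bound \<open>3/2\<close> on Lagrange ratios, \<open>\<bar>s j c_j\<bar>\<close> is at most
  \<open>3/2 (\<bar>u k\<bar> / \<bar>u j\<bar>) \<Sum>_i s (k+i) \<bar>c_(k+i)\<bar>\<close>. Here \<open>\<bar>u k\<bar> / \<bar>u j\<bar> \<le> 2^{-(k-j)}\<close>, and the sum is at most
  \<open>s k\<close> times \<open>sqrt (4/3) \<parallel>c2\<parallel>\<close> by Cauchy-Schwarz. Squares therefore sum to at most
  \<open>9/4 * 4/3 * \<Sum>_j 4^{-(k-j)} \<le> 1\<close> times \<open>(s k)^2 \<parallel>c2\<parallel>^2\<close>.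
\<close>

lemma orthogonal_head_le:
  assumes half: "\<And>i. Suc i < n \<Longrightarrow> 2 * s (Suc i) \<le> s i"
    and u_tail: "\<And>i. k \<le> i \<Longrightarrow> i < n \<Longrightarrow> \<bar>u i\<bar> \<le> \<bar>u k\<bar>"
    and u_head: "\<And>j. j < k \<Longrightarrow> \<bar>u k\<bar> * s j \<le> \<bar>u j\<bar> * s k"
    and x: "x \<in> carrier_vec n" and k: "k < n"
    and orth: "\<And>j. 1 \<le> j \<Longrightarrow> j \<le> k \<Longrightarrow> q j \<bullet> x = 0"
  defines "c \<equiv> V\<^sup>T *\<^sub>v x"
  shows "(\<Sum>j<k. (s j * c $ j)\<^sup>2) \<le> (s k)\<^sup>2 * (\<Sum>i<n - k. (c $ (k + i))\<^sup>2)"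
proof -
  let ?C = "\<Sum>i<n - k. (c $ (k + i))\<^sup>2"
  let ?E = "\<Sum>i<n - k. (1 / 2) ^ i * \<bar>c $ (k + i)\<bar>"
  have sk: "0 < s k" using s_pos k by simp
  have half_sq: "((1 / 2 :: real) ^ i)\<^sup>2 = (1 / 4) ^ i" for i
    by (simp add: power2_eq_square flip: power_mult_distrib)
  have "?E \<le> L2_set (\<lambda>i. (1 / 2) ^ i) {..<n - k} * L2_set (\<lambda>i. c $ (k + i)) {..<n - k}"
    using L2_set_mult_ineq[of "\<lambda>i. (1 / 2) ^ i" "\<lambda>i. c $ (k + i)" "{..<n - k}"] by (simp add: abs_of_nonneg)
  then have "?E\<^sup>2 \<le> (L2_set (\<lambda>i. (1 / 2) ^ i) {..<n - k} * L2_set (\<lambda>i. c $ (k + i)) {..<n - k})\<^sup>2"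
    by (intro power_mono sum_nonneg) auto
  also have "\<dots> = (\<Sum>i<n - k. (1 / 4) ^ i) * ?C"
    by (simp add: power_mult_distrib L2_set_def sum_nonneg half_sq)
  also have "\<dots> \<le> 4 / 3 * ?C"
    using sum_quarter_powers_up by (intro mult_right_mono sum_nonneg) auto
  finally have E: "?E\<^sup>2 \<le> 4 / 3 * ?C" .
  have E0: "0 \<le> ?E" by (intro sum_nonneg) auto
  have entry: "(s j * c $ j)\<^sup>2 \<le> 3 * (s k)\<^sup>2 * ?C * (1 / 4) ^ (k - j)" if j: "j < k" for j
  proof -
    let ?L = "lagrange k j"
    define P where "P = \<bar>poly ?L ((s j)\<^sup>2)\<bar>"
    have P: "0 < P" using lagrange_self_nz[OF j] k by (simp add: P_def)
    have uj: "0 < \<bar>u j\<bar>" using u_nz[of j] j k by simp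
    have sj: "0 < s j" using s_pos[of j] j k by simp
    have "P * \<bar>u j\<bar> * \<bar>s j * c $ j\<bar> = \<bar>poly ?L ((s j)\<^sup>2) * s j * u j * c $ j\<bar>"
      by (simp add: P_def abs_mult)
    also have "\<dots> \<le> (\<Sum>i<n - k. \<bar>poly ?L ((s (k + i))\<^sup>2) * s (k + i) * u (k + i) * c $ (k + i)\<bar>)"
      using lagrange_orthogonal[OF x k j orth] unfolding c_def[symmetric] by (simp add: sum_abs)
    also have "\<dots> \<le> (\<Sum>i<n - k. (3 / 2 * P * \<bar>u k\<bar> * s k) * ((1 / 2) ^ i * \<bar>c $ (k + i)\<bar>))"
    proof (rule sum_mono)
      fix i assume "i \<in> {..<n - k}"
      then have i: "k + i < n" by simp
      have "\<bar>poly ?L ((s (k + i))\<^sup>2) * s (k + i) * u (k + i) * c $ (k + i)\<bar> =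
          \<bar>poly ?L ((s (k + i))\<^sup>2)\<bar> * (s (k + i) * (\<bar>u (k + i)\<bar> * \<bar>c $ (k + i)\<bar>))"
        using s_pos[OF i] by (simp add: abs_mult)
      also have "\<dots> \<le> (3 / 2 * P) * (((1 / 2) ^ i * s k) * (\<bar>u k\<bar> * \<bar>c $ (k + i)\<bar>))"
        using lagrange_ratio_le[OF half j _ i] halving_power[OF half i] u_tail[OF _ i] s_pos[OF i] sk P
        by (intro mult_mono) (auto simp: P_def)
      finally show "\<bar>poly ?L ((s (k + i))\<^sup>2) * s (k + i) * u (k + i) * c $ (k + i)\<bar>
          \<le> (3 / 2 * P * \<bar>u k\<bar> * s k) * ((1 / 2) ^ i * \<bar>c $ (k + i)\<bar>)" by (simp add: mult_ac)
    qed
    also have "\<dots> = P * (3 / 2 * \<bar>u k\<bar> * s k * ?E)" by (simp add: sum_distrib_left mult_ac)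
    finally have 1: "\<bar>u j\<bar> * \<bar>s j * c $ j\<bar> \<le> 3 / 2 * \<bar>u k\<bar> * s k * ?E"
      using P by (simp add: mult.assoc)
    have "\<bar>u k\<bar> * s j \<le> \<bar>u j\<bar> * ((1 / 2) ^ (k - j) * s j)"
      using u_head[OF j] halving_power[OF half, of j "k - j"] j k uj
      by (auto intro: order_trans mult_left_mono)
    then have "\<bar>u k\<bar> \<le> \<bar>u j\<bar> * (1 / 2) ^ (k - j)" using sj by (simp flip: mult.assoc)
    then have "3 / 2 * \<bar>u k\<bar> * s k * ?E \<le> 3 / 2 * (\<bar>u j\<bar> * (1 / 2) ^ (k - j)) * s k * ?E"
      using sk E0 by (intro mult_right_mono mult_left_mono) auto
    with 1 have "\<bar>u j\<bar> * \<bar>s j * c $ j\<bar> \<le> \<bar>u j\<bar> * (3 / 2 * (1 / 2) ^ (k - j) * s k * ?E)"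
      by (simp add: mult_ac)
    then have "\<bar>s j * c $ j\<bar> \<le> 3 / 2 * (1 / 2) ^ (k - j) * s k * ?E"
      using uj by (rule mult_left_le_imp_le)
    then have "(s j * c $ j)\<^sup>2 \<le> (3 / 2 * (1 / 2) ^ (k - j) * s k * ?E)\<^sup>2"
      by (metis abs_ge_zero power2_abs power_mono)
    also have "\<dots> = 9 / 4 * (1 / 4) ^ (k - j) * (s k)\<^sup>2 * ?E\<^sup>2"
      by (simp add: power_mult_distrib power2_eq_square flip: power_mult_distrib)
    also have "\<dots> \<le> 9 / 4 * (1 / 4) ^ (k - j) * (s k)\<^sup>2 * (4 / 3 * ?C)"
      using E by (intro mult_left_mono) auto
    finally show ?thesis by (simp add: mult_ac)
  qed
  have "(\<Sum>j<k. (s j * c $ j)\<^sup>2) \<le> (\<Sum>j<k. 3 * (s k)\<^sup>2 * ?C * (1 / 4) ^ (k - j))"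
    using entry by (intro sum_mono) auto
  also have "\<dots> = 3 * (s k)\<^sup>2 * ?C * (\<Sum>j<k. (1 / 4) ^ (k - j))" by (simp add: sum_distrib_left)
  also have "\<dots> \<le> 3 * (s k)\<^sup>2 * ?C * (1 / 3)"
    using sum_quarter_powers by (intro mult_left_mono mult_nonneg_nonneg sum_nonneg) auto
  finally show ?thesis by simp
qed

lemma gamma_le_sqrt2:
  assumes half: "\<And>i. Suc i < n \<Longrightarrow> 2 * s (Suc i) \<le> s i"
    and u_tail: "\<And>i. k \<le> i \<Longrightarrow> i < n \<Longrightarrow> \<bar>u i\<bar> \<le> \<bar>u k\<bar>"
    and u_head: "\<And>j. j < k \<Longrightarrow> \<bar>u k\<bar> * s j \<le> \<bar>u j\<bar> * s k"
    and k: "1 \<le> k" "k < n"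
  shows "gamma A b k \<le> sqrt 2 * s k"
  unfolding gamma_def
proof (rule norm2_mat_le)
  fix w assume "w \<in> carrier_vec (dim_col (A - lanczos_approx A b k))" and w1: "norm2_vec w \<le> 1"
  then have w: "w \<in> carrier_vec n" using approx_carrier[of k] by simp
  obtain x where x: "x \<in> carrier_vec n" "norm2_vec x \<le> norm2_vec w"
    and Ax: "(A - lanczos_approx A b k) *\<^sub>v w = A *\<^sub>v x"
    and orth: "\<And>j. 1 \<le> j \<Longrightarrow> j \<le> k \<Longrightarrow> q j \<bullet> x = 0"
    using lanczos_residual[OF k w] by metis
  let ?C = "\<Sum>i<n - k. ((V\<^sup>T *\<^sub>v x) $ (k + i))\<^sup>2"
  have "(norm2_vec x)\<^sup>2 \<le> 1" using x(2) w1 by (intro power_le_one) auto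
  then have "(s k)\<^sup>2 * ?C \<le> (s k)\<^sup>2"
    using sum_tail_le_norm[OF x(1) k(2)] by (intro mult_left_le) auto
  then have "(norm2_vec (A *\<^sub>v x))\<^sup>2 \<le> 2 * (s k)\<^sup>2"
    using norm_A_sq_le_split[OF x(1) k(2)] orthogonal_head_le[OF half u_tail u_head x(1) k(2) orth]
    by linarith
  then have "norm2_vec (A *\<^sub>v x) \<le> sqrt (2 * (s k)\<^sup>2)" by (rule real_le_rsqrt)
  then show "norm2_vec ((A - lanczos_approx A b k) *\<^sub>v w) \<le> sqrt 2 * s k"
    unfolding Ax using s_pos[of k] k by (simp add: real_sqrt_mult)
qed


section \<open>Near best approximation\<close>

lemma near_bestI:
  assumes k: "1 \<le> k" "k < n" and lt: "gamma A b k < (\<sigma> k + \<sigma> (Suc k)) / 2"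
  shows "near_best A b \<sigma> k"
proof -
  have "\<sigma> (Suc k) < \<sigma> k" using \<sigma>_dec k by simp
  moreover have "\<sigma> (Suc k) \<le> gamma A b k" using gamma_ge_singular_value[OF k] by (simp add: s_def)
  ultimately show ?thesis using lt by (simp add: near_best_def field_simps)
qed

lemma near_best_if_eta:
  assumes k: "1 \<le> k" "k < n"
    and eta: "sqrt (1 + (eta n U \<sigma> b k)\<^sup>2) < 1 / 2 * (\<sigma> k / \<sigma> (Suc k)) + 1 / 2"
  shows "near_best A b \<sigma> k"
proof (rule near_bestI[OF k])
  have pos: "0 < \<sigma> (Suc k)" using s_pos[OF k(2)] by (simp add: s_def)
  have "gamma A b k \<le> \<sigma> (Suc k) * sqrt (1 + (eta n U \<sigma> b k)\<^sup>2)"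
    using gamma_le_eta[OF k] by (simp add: s_def)
  also have "\<dots> < \<sigma> (Suc k) * (1 / 2 * (\<sigma> k / \<sigma> (Suc k)) + 1 / 2)"
    using eta pos by (rule mult_strict_left_mono)
  also have "\<dots> = (\<sigma> k + \<sigma> (Suc k)) / 2" using pos by (simp add: field_simps)
  finally show "gamma A b k < (\<sigma> k + \<sigma> (Suc k)) / 2" .
qed

lemma near_best_if_halving:
  assumes half: "\<And>i. Suc i < n \<Longrightarrow> 2 * s (Suc i) \<le> s i"
    and u_tail: "\<And>i. k \<le> i \<Longrightarrow> i < n \<Longrightarrow> \<bar>u i\<bar> \<le> \<bar>u k\<bar>"
    and u_head: "\<And>j. j < k \<Longrightarrow> \<bar>u k\<bar> * s j \<le> \<bar>u j\<bar> * s k"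
    and k: "1 \<le> k" "k < n"
  shows "near_best A b \<sigma> k"
proof (rule near_bestI[OF k])
  have "sqrt 2 < 3 / 2" by (rule real_less_lsqrt) (auto simp: power2_eq_square)
  then have "gamma A b k < 3 / 2 * s k"
    using gamma_le_sqrt2[OF half u_tail u_head k] mult_strict_right_mono[OF _ s_pos[OF k(2)]]
    by (meson le_less_trans)
  moreover have "2 * s k \<le> \<sigma> k" using half[of "k - 1"] k by (simp add: s_def)
  ultimately show "gamma A b k < (\<sigma> k + \<sigma> (Suc k)) / 2" by (simp add: s_def)
qed

end

text \<open>
  The ratio condition at \<open>k = k0\<close> extends the law \<open>\<bar>u_j^T b\<bar> = \<sigma>_j^{1+\<beta>}\<close> to the index \<open>k0 + 1\<close>. Hence
  \<open>\<bar>u_{k+1}^T b\<bar> / \<bar>u_j^T b\<bar> = (\<sigma>_{k+1} / \<sigma>_j)^{1+\<beta>}\<close>, which is at most \<open>\<sigma>_{k+1} / \<sigma>_j\<close>.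
\<close>

lemma picard_ucoef_ratio_le:
  assumes pm: "picard_model m n U \<sigma> b bhat e \<beta> \<epsilon> k0"
    and pos: "\<And>i. 1 \<le> i \<Longrightarrow> i \<le> n \<Longrightarrow> 0 < \<sigma> i"
    and j: "1 \<le> j" "j \<le> k" "k \<le> k0" and le: "\<sigma> (Suc k) \<le> \<sigma> j"
  shows "\<bar>ucoef U b (Suc k)\<bar> * \<sigma> j \<le> \<bar>ucoef U b j\<bar> * \<sigma> (Suc k)"
proof -
  have kn: "k < n" and \<beta>: "0 < \<beta>" using pm j by (auto simp: picard_model_def)
  have p: "0 < \<sigma> j" "0 < \<sigma> k" "0 < \<sigma> (Suc k)" using pos j kn by auto
  have "\<bar>ucoef U b (Suc k)\<bar> / \<bar>ucoef U b k\<bar> = (\<sigma> (Suc k) / \<sigma> k) powr (1 + \<beta>)"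
    and uk: "\<bar>ucoef U b k\<bar> = \<sigma> k powr (1 + \<beta>)" and uj: "\<bar>ucoef U b j\<bar> = \<sigma> j powr (1 + \<beta>)"
    using pm j kn by (auto simp: picard_model_def)
  then have "\<bar>ucoef U b (Suc k)\<bar> = (\<sigma> (Suc k) / \<sigma> k) powr (1 + \<beta>) * \<sigma> k powr (1 + \<beta>)"
    using p by (simp add: field_simps)
  also have "\<dots> = \<sigma> (Suc k) powr (1 + \<beta>)" using p by (simp add: powr_divide)
  finally have "\<bar>ucoef U b (Suc k)\<bar> * \<sigma> j = \<sigma> (Suc k) * \<sigma> j * \<sigma> (Suc k) powr \<beta>"
    using p by (simp add: powr_add)
  also have "\<dots> \<le> \<sigma> (Suc k) * \<sigma> j * \<sigma> j powr \<beta>"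
    using p le \<beta> by (intro mult_left_mono powr_mono2) auto
  also have "\<dots> = \<bar>ucoef U b j\<bar> * \<sigma> (Suc k)" using p uj by (simp add: powr_add)
  finally show ?thesis .
qed

lemma picard_ucoef_decreasing:
  assumes pm: "picard_model m n U \<sigma> b bhat e \<beta> \<epsilon> k0" and i: "1 \<le> i" "i \<le> j" "j \<le> n"
  shows "\<bar>ucoef U b j\<bar> \<le> \<bar>ucoef U b i\<bar>"
  using i(2,3)
proof (induction j rule: dec_induct)
  case (step j)
  then have "\<bar>ucoef U b (Suc j)\<bar> \<le> \<bar>ucoef U b j\<bar>" using pm i(1) by (auto simp: picard_model_def)
  then show ?case using step by simp
qed simp

theorem theorem7:
  fixes A U V :: "real mat" and b bhat e :: "real vec" and \<sigma> :: "nat \<Rightarrow> real"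
    and m n k0 :: nat and \<beta> \<epsilon> :: real
  assumes "m \<ge> n"
    and "A \<in> carrier_mat m n" and "b \<in> carrier_vec m"
    and "is_svd m n A U \<sigma> V"
    and "\<forall>i\<in>{1..<n}. \<sigma> (Suc i) < \<sigma> i" and "\<sigma> n > 0"
    and "picard_model m n U \<sigma> b bhat e \<beta> \<epsilon> k0"
  shows
    "(\<forall>k\<in>{1..k0}. sqrt (1 + (eta n U \<sigma> b k)\<^sup>2) < 1 / 2 * (\<sigma> k / \<sigma> (Suc k)) + 1 / 2
        \<longrightarrow> near_best A b \<sigma> k)
     \<and> (\<forall>(\<zeta>::real) (\<rho>::real). \<zeta> > 0 \<and> \<rho> > 1
          \<and> (\<forall>k\<in>{1..n}. \<sigma> k = \<zeta> * \<rho> powr (- real k)) \<and> \<rho> > 2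
        \<longrightarrow> (\<forall>k\<in>{1..k0}. near_best A b \<sigma> k))
     \<and> (\<forall>(\<zeta>::real) (\<alpha>::real). \<zeta> > 0 \<and> \<alpha> > 1 / 2
          \<and> (\<forall>k\<in>{1..n}. \<sigma> k = \<zeta> * real k powr (- \<alpha>))
        \<longrightarrow> (\<forall>k\<in>{1..k0}.
              2 * sqrt (1 + (eta n U \<sigma> b k)\<^sup>2) - 1 < (real (k0 + 1) / real k0) powr \<alpha>
              \<longrightarrow> near_best A b \<sigma> k))"
proof -
  note pm = assms(7)
  have k0n: "k0 < n" using pm by (auto simp: picard_model_def)
  have sigma_antimono: "\<sigma> j \<le> \<sigma> i" if "1 \<le> i" "i \<le> j" "j \<le> n" for i j
    using that(2,3)
  proof (induction j rule: dec_induct)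
    case (step j)
    then have "\<sigma> (Suc j) < \<sigma> j" using assms(5) that(1) by auto
    then show ?case using step by simp
  qed simp
  have sigma_gt_0: "0 < \<sigma> i" if "1 \<le> i" "i \<le> n" for i
    using sigma_antimono[of i n] that assms(6) by simp
  have "ucoef U b i \<noteq> 0" if i: "1 \<le> i" "i \<le> n" for i
  proof (cases "i \<le> k0")
    case True
    then have "\<bar>ucoef U b i\<bar> = \<sigma> i powr (1 + \<beta>)" using pm i by (auto simp: picard_model_def)
    then show ?thesis using sigma_gt_0[OF i] by auto
  next
    case False
    then have "\<bar>ucoef U b i\<bar> = \<epsilon>" "0 < \<epsilon>" using pm i by (auto simp: picard_model_def)
    then show ?thesis by auto
  qed
  then interpret lanczos_svd A b m n U V \<sigma>
    using assms k0n by unfold_locales auto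
  have part1: "near_best A b \<sigma> k"
    if "k \<in> {1..k0}" "sqrt (1 + (eta n U \<sigma> b k)\<^sup>2) < 1 / 2 * (\<sigma> k / \<sigma> (Suc k)) + 1 / 2" for k
    using near_best_if_eta[of k] that k0n by auto
  have part2: "near_best A b \<sigma> k"
    if \<sigma>: "\<forall>k\<in>{1..n}. \<sigma> k = \<zeta> * \<rho> powr (- real k)" and \<rho>: "2 < \<rho>" and k: "k \<in> {1..k0}" for \<zeta> \<rho> k
  proof (rule near_best_if_halving)
    show "1 \<le> k" "k < n" using k k0n by auto
    fix i assume i: "Suc i < n"
    have "s i = \<zeta> * \<rho> powr (- real (Suc (Suc i)) + 1)" using \<sigma> i by (simp add: s_def)
    also have "\<dots> = \<rho> * s (Suc i)" unfolding powr_add using \<sigma> i \<rho> by (simp add: s_def)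
    finally have "s i = \<rho> * s (Suc i)" .
    then show "2 * s (Suc i) \<le> s i" using \<rho> s_pos[OF i] by simp
  next
    fix i assume "k \<le> i" "i < n"
    then show "\<bar>u i\<bar> \<le> \<bar>u k\<bar>"
      unfolding u_def by (intro picard_ucoef_decreasing[OF pm]) auto
  next
    fix j assume "j < k"
    then show "\<bar>u k\<bar> * s j \<le> \<bar>u j\<bar> * s k"
      unfolding u_def s_def using k k0n
      by (intro picard_ucoef_ratio_le[OF pm sigma_gt_0] sigma_antimono) auto
  qed
  have part3: "near_best A b \<sigma> k"
    if \<zeta>: "0 < \<zeta>" and \<alpha>: "1 / 2 < \<alpha>" and \<sigma>: "\<forall>k\<in>{1..n}. \<sigma> k = \<zeta> * real k powr (- \<alpha>)"
      and k: "k \<in> {1..k0}"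
      and eta: "2 * sqrt (1 + (eta n U \<sigma> b k)\<^sup>2) - 1 < (real (k0 + 1) / real k0) powr \<alpha>" for \<zeta> \<alpha> k
  proof (rule part1[OF k])
    have "real (k0 + 1) / real k0 \<le> real (Suc k) / real k"
      using k by (simp add: field_simps)
    then have "(real (k0 + 1) / real k0) powr \<alpha> \<le> (real (Suc k) / real k) powr \<alpha>"
      using \<alpha> by (intro powr_mono2) auto
    also have "\<dots> = \<sigma> k / \<sigma> (Suc k)"
    proof -
      have "\<sigma> k = \<zeta> * real k powr (- \<alpha>)" "\<sigma> (Suc k) = \<zeta> * real (Suc k) powr (- \<alpha>)"
        using \<sigma> k k0n by auto
      note eqs = this
      show ?thesis unfolding eqs using \<zeta> k by (simp add: powr_minus powr_divide field_simps)
    qed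
    finally show "sqrt (1 + (eta n U \<sigma> b k)\<^sup>2) < 1 / 2 * (\<sigma> k / \<sigma> (Suc k)) + 1 / 2"
      using eta by linarith
  qed
  show ?thesis using part1 part2 part3 by blast
qed

end
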